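(* Fix $K>1$ and a distribution $F$ over the simplex $V=\{x\in\mathbb{R}^K:x_k\ge0,\ \sum_kx_k=1\}$, and let $h=\mathbb{E}[\pi_i]$ for $\pi_i\sim F$. Consider a sequence of DCMM model pairs indexed by $n$: $$H_0^{(n)}:\ \Omega=q_n\cdot\theta\theta'\qquad\text{and}\qquad H_1^{(n)}:\ \Omega=\Theta\Pi P\Pi'\Theta,$$ where $\Theta=\mathrm{diag}(\theta_1,\ldots,\theta_n)$, $\Pi=[\pi_1,\ldots,\pi_n]'$ with $\pi_i\stackrel{iid}{\sim}F$, and $(P,h,q_n)$ satisfy $Ph=q_n1_K$ with $q_n>0$. If $\theta_{\max}\le c_0$ for a constant $c_0<1$, $$\min_{1\le k\le K}\{h_k\}\ge C,\qquad\text{and}\qquad\|\theta\|\cdot|\mu_2(P)|\to0,$$ for a constant $C>0$, then for each pair of two hypotheses the $\chi^2$-distance between the two joint distributions tends to $0$ as $n\to\infty$.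
   Context: $\theta\in\mathbb{R}^n$ has positive entries; $P\in\mathbb{R}^{K\times K}$ is symmetric, entrywise nonnegative, with unit diagonal; $\theta$ and $P$ are non-stochastic and may depend on $n$. Given $\Omega$ (possibly random through $\Pi$), the adjacency matrix $A\in\{0,1\}^{n\times n}$ is symmetric with zero diagonal, and its entries $A_{ij}$, $i<j$, are conditionally independent Bernoulli with $\mathbb{P}(A_{ij}=1\mid\Omega)=\Omega_{ij}\in[0,1]$. The two joint distributions are the laws $P_0^{(n)}$, $P_1^{(n)}$ of $A$ under $H_0^{(n)}$ and $H_1^{(n)}$ (under $H_1^{(n)}$, averaged over $\Pi$). Their $\chi^2$-distance is $\int(dP_1^{(n)}/dP_0^{(n)})^2\,dP_0^{(n)}-1$. $\mu_k(P)$ is the $k$-th largest eigenvalue of $P$ in magnitude. $\|\theta\|$ is the $\ell^2$-norm, $\theta_{\max}=\max_i\theta_i$, $1_K$ is the all-ones vector. *)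

theory Defs
  imports "HOL-Probability.Probability" "HOL-Computational_Algebra.Polynomial"
begin

definition prob_simplex :: "(real ^ 'k) set" where
  "prob_simplex = {x. (\<forall>k. 0 \<le> x $ k) \<and> (\<Sum>k\<in>UNIV. x $ k) = 1}"

definition char_poly_matrix :: "real ^ 'k ^ 'k \<Rightarrow> real poly" where
  "char_poly_matrix P = det (\<chi> i j. (if i = j then [:0, 1:] else 0) - [:P $ i $ j:])"

text \<open>The \<open>k\<close>-th largest eigenvalue in magnitude (counted from \<open>k = 1\<close>). Eigenvalues are counted with
  multiplicity, as roots of the characteristic polynomial; for a symmetric matrix all of them are
  real. Of two opposite eigenvalues of equal magnitude the positive one comes first.\<close>
definition eigval_mag :: "nat \<Rightarrow> real ^ 'k ^ 'k \<Rightarrow> real" where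
  "eigval_mag k P =
     rev (sort_key abs (sorted_list_of_multiset (proots (char_poly_matrix P)))) ! (k - 1)"

text \<open>Nodes are \<open>0, \<dots>, n - 1\<close>, and matrices indexed by nodes are functions. The law of the adjacency
  matrix given \<open>\<Omega>\<close>: independent Bernoulli entries above the diagonal, extended symmetrically; the
  diagonal and all entries with an index \<open>\<ge> n\<close> get the default value \<open>False\<close>, that is \<open>0\<close>.
  (\<open>bernoulli_pmf\<close> clips its parameter to \<open>[0, 1]\<close>; this never matters when \<open>\<Omega> i j\<close> is a
  probability for \<open>i < j < n\<close>.)\<close>
definition adj_law :: "nat \<Rightarrow> (nat \<Rightarrow> nat \<Rightarrow> real) \<Rightarrow> (nat \<Rightarrow> nat \<Rightarrow> nat) pmf" where
  "adj_law n \<Omega> =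
     map_pmf (\<lambda>E i j. of_bool (E (min i j, max i j)))
       (Pi_pmf {(i, j). i < j \<and> j < n} False (\<lambda>(i, j). bernoulli_pmf (\<Omega> i j)))"

definition Omega_null :: "(nat \<Rightarrow> real) \<Rightarrow> real \<Rightarrow> nat \<Rightarrow> nat \<Rightarrow> real" where
  "Omega_null \<theta> q i j = q * (\<theta> i * \<theta> j)"

text \<open>The \<open>(i, j)\<close> entry of \<open>\<Theta> \<Pi> P \<Pi>' \<Theta>\<close>, where row \<open>i\<close> of \<open>\<Pi>\<close> is the membership vector \<open>\<pi> i\<close>.\<close>
definition Omega_alt :: "(nat \<Rightarrow> real) \<Rightarrow> real ^ 'k ^ 'k \<Rightarrow> (nat \<Rightarrow> real ^ 'k) \<Rightarrow> nat \<Rightarrow> nat \<Rightarrow> real" where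
  "Omega_alt \<theta> P \<pi> i j = \<theta> i * (\<pi> i \<bullet> (P *v \<pi> j)) * \<theta> j"

definition membership_law :: "nat \<Rightarrow> (real ^ 'k) measure \<Rightarrow> (nat \<Rightarrow> real ^ 'k) measure" where
  "membership_law n F = PiM {..<n} (\<lambda>_. F)"

definition law_null :: "nat \<Rightarrow> (nat \<Rightarrow> real) \<Rightarrow> real \<Rightarrow> (nat \<Rightarrow> nat \<Rightarrow> nat) measure" where
  "law_null n \<theta> q = measure_pmf (adj_law n (Omega_null \<theta> q))"

definition law_alt ::
  "nat \<Rightarrow> (nat \<Rightarrow> real) \<Rightarrow> real ^ 'k ^ 'k \<Rightarrow> (real ^ 'k) measure \<Rightarrow> (nat \<Rightarrow> nat \<Rightarrow> nat) measure" where
  "law_alt n \<theta> P F =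
     membership_law n F \<bind> (\<lambda>\<pi>. measure_pmf (adj_law n (Omega_alt \<theta> P \<pi>)))"

text \<open>\<open>RN_deriv\<close> is \<open>0\<close> when there is no density, hence the case distinction; without absolute
  continuity the distance is infinite, as usual.\<close>
definition chi_square_dist :: "'a measure \<Rightarrow> 'a measure \<Rightarrow> ereal" where
  "chi_square_dist P0 P1 =
     (if absolutely_continuous P0 P1
      then enn2ereal (\<integral>\<^sup>+ x. (RN_deriv P0 P1 x)\<^sup>2 \<partial>P0) - 1 else \<infinity>)"

end

theory Submission imports Defs
begin

text \<open>
  Write \<open>p\<^sub>i\<^sub>j = q \<theta>\<^sub>i \<theta>\<^sub>j\<close> for the edge probabilities under the null and \<open>\<delta>\<^sub>i\<^sub>j\<close> for the difference between the
  edge probability under the alternative (given the memberships) and \<open>p\<^sub>i\<^sub>j\<close>. The condition \<open>P h = q 1\<close>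
  says exactly that \<open>\<delta>\<^sub>i\<^sub>j = \<theta>\<^sub>i \<theta>\<^sub>j (\<pi>\<^sub>i - h) \<bullet> P (\<pi>\<^sub>j - h)\<close>, so the mean of \<open>\<delta>\<^sub>i\<^sub>j\<close> over \<open>\<pi>\<^sub>i\<close> alone
  vanishes.

  Expanding the product of the edge likelihoods in the \<open>\<delta>\<^sub>e\<close> and using orthogonality of the resulting
  functions of the graph, one obtains the exact formula (\<open>chi_square_expansion\<close>)
  \<open>1 + \<chi>\<^sup>2 = \<Sum>\<^sub>G (E \<Prod>\<^sub>e\<^sub>\<in>\<^sub>G \<delta>\<^sub>e)\<^sup>2 / \<Prod>\<^sub>e\<^sub>\<in>\<^sub>G p\<^sub>e (1 - p\<^sub>e)\<close>, the sum being over all graphs \<open>G\<close> on the nodes.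
  Integrating out the membership of a leaf first shows that graphs with a node of degree one contribute
  nothing (\<open>subgraph_mean_leaf\<close>).

  The other terms are small because \<open>\<bar>\<delta>\<^sub>i\<^sub>j\<bar> \<le> c \<bar>\<mu>\<^sub>2(P)\<bar> \<theta>\<^sub>i \<theta>\<^sub>j\<close>: up to an operator of norm \<open>\<bar>\<mu>\<^sub>2(P)\<bar>\<close> the matrix
  \<open>P\<close> has rank one, and \<open>P h = q 1\<close> forces its leading eigenvector to be nearly parallel to the all-ones
  vector, hence nearly orthogonal to \<open>\<pi>\<^sub>i - h\<close> (\<open>bilinear_bound_sum_zero\<close>). The same bound controls
  \<open>\<bar>q - 1\<bar>\<close>, which together with \<open>\<theta>\<^sub>m\<^sub>a\<^sub>x \<le> c\<^sub>0 < 1\<close> keeps \<open>1 - p\<^sub>e\<close> away from zero.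

  It remains to sum \<open>\<Prod>\<^sub>e\<^sub>\<in>\<^sub>G \<kappa> \<theta>\<^sub>i \<theta>\<^sub>j\<close> over the graphs without leaves, where \<open>\<kappa>\<close> is of order \<open>\<mu>\<^sub>2(P)\<^sup>2\<close>.
  Let \<open>g\<^sub>i\<close> be independent, equal to \<open>2\<close> with probability \<open>1/3\<close> and to \<open>-1\<close> with probability \<open>2/3\<close>. The
  mean of \<open>g\<^sub>i\<close> is zero and its other moments are at least one, so the sum is at most
  \<open>E \<Prod>\<^sub>i\<^sub><\<^sub>j (1 + \<kappa> \<theta>\<^sub>i \<theta>\<^sub>j g\<^sub>i g\<^sub>j) \<le> E exp (\<kappa>/2 (\<Sum>\<^sub>i \<theta>\<^sub>i g\<^sub>i)\<^sup>2)\<close>. As \<open>\<Sum>\<^sub>i \<theta>\<^sub>i g\<^sub>i\<close> is sub-Gaussian, this is at most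
  \<open>(1 - 9/4 \<kappa> \<parallel>\<theta>\<parallel>\<^sup>2)\<close> to the power \<open>-1/2\<close> (\<open>sum_graphs_le\<close>), and \<open>\<kappa> \<parallel>\<theta>\<parallel>\<^sup>2\<close> is of order
  \<open>(\<parallel>\<theta>\<parallel> \<mu>\<^sub>2(P))\<^sup>2\<close>, which tends to zero.
\<close>

section \<open>Eigenvalues of symmetric matrices\<close>

text \<open>A maximiser \<open>v\<close> of the quadratic form on the unit sphere of \<open>S\<close> is an eigenvector: with
  \<open>w = f v - l v\<close>, comparing the values of the form at \<open>v\<close> and at \<open>v + t w\<close> for small \<open>t > 0\<close> leaves
  no room for \<open>w \<noteq> 0\<close>.\<close>
lemma symmetric_eigenvector_exists:
  fixes f :: "'a::euclidean_space \<Rightarrow> 'a"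
  assumes lin: "linear f" and sym: "\<And>x y. f x \<bullet> y = x \<bullet> f y"
    and S: "subspace S" and inv: "\<And>x. x \<in> S \<Longrightarrow> f x \<in> S" and ne: "S \<noteq> {0}"
  obtains v l where "v \<in> S" "norm v = 1" "f v = l *\<^sub>R v"
proof -
  have cont: "continuous_on X (\<lambda>x. x \<bullet> f x)" for X
    by (intro continuous_intros linear_continuous_on linear_linear[THEN iffD2] lin)
  obtain x where x: "x \<in> S" "x \<noteq> 0" using ne subspace_0[OF S] by auto
  have "x /\<^sub>R norm x \<in> S \<inter> sphere 0 1" using x S by (auto simp: subspace_def)
  then have "S \<inter> sphere 0 1 \<noteq> {}" by blast
  moreover have "compact (S \<inter> sphere 0 1)"
    using closed_subspace[OF S] by (simp add: closed_Int_compact)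
  ultimately obtain v where v: "v \<in> S" "norm v = 1"
    and max: "\<And>y. y \<in> S \<Longrightarrow> norm y = 1 \<Longrightarrow> y \<bullet> f y \<le> v \<bullet> f v"
    using continuous_attains_sup[OF _ _ cont] by (metis IntE IntI dist_0_norm mem_sphere)
  define l where "l = v \<bullet> f v"
  have max': "y \<bullet> f y \<le> l * (y \<bullet> y)" if "y \<in> S" for y
  proof (cases "y = 0")
    case False
    have "(y /\<^sub>R norm y) \<bullet> f (y /\<^sub>R norm y) \<le> l"
      unfolding l_def using that False S by (intro max) (auto simp: subspace_def)
    then have "(y \<bullet> f y) / (norm y)\<^sup>2 \<le> l"
      using linear_scale[OF lin] by (simp add: field_simps power2_eq_square)
    then show ?thesis using False by (simp add: field_simps power2_norm_eq_inner)
  qed (simp add: linear_0[OF lin])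
  define w where "w = f v - l *\<^sub>R v"
  have vv: "v \<bullet> v = 1" using v by (simp add: norm_eq_1)
  have wS: "w \<in> S" unfolding w_def using v inv S by (simp add: subspace_diff subspace_scale)
  have wv: "v \<bullet> w = 0" by (simp add: w_def inner_diff_right l_def vv)
  have ww: "f v \<bullet> w = w \<bullet> w" using wv by (simp add: w_def inner_diff_left inner_diff_right inner_commute)
  define b where "b = l * (w \<bullet> w) - w \<bullet> f w"
  have q: "2 * t * (w \<bullet> w) \<le> t\<^sup>2 * b" for t
  proof -
    have "v + t *\<^sub>R w \<in> S" using v wS S by (simp add: subspace_add subspace_scale)
    from max'[OF this] have "(v + t *\<^sub>R w) \<bullet> f (v + t *\<^sub>R w) \<le> l * ((v + t *\<^sub>R w) \<bullet> (v + t *\<^sub>R w))" .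
    moreover have "v \<bullet> f w = w \<bullet> w" "w \<bullet> f v = w \<bullet> w" using ww sym by (metis, metis inner_commute)
    ultimately show ?thesis
      using wv vv by (simp add: linear_add[OF lin] linear_scale[OF lin] inner_add_left inner_add_right
        inner_commute[of w v] b_def l_def[symmetric] power2_eq_square algebra_simps)
  qed
  have "w \<bullet> w = 0"
  proof (rule ccontr)
    assume "w \<bullet> w \<noteq> 0"
    then have p: "w \<bullet> w > 0" by simp
    define t where "t = (w \<bullet> w) / (1 + \<bar>b\<bar>)"
    have t: "t > 0" using p by (simp add: t_def)
    have "2 * (w \<bullet> w) \<le> t * b" using q[of t] t by (simp add: power2_eq_square)
    also have "\<dots> \<le> t * (1 + \<bar>b\<bar>)" using t by (intro mult_left_mono) auto
    also have "\<dots> = w \<bullet> w" by (simp add: t_def add_nonneg_eq_0_iff)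
    finally show False using p by simp
  qed
  then have "f v = l *\<^sub>R v" by (simp add: w_def)
  then show thesis using that v by blast
qed

text \<open>The spectral theorem, by splitting off one eigenvector \<open>v\<close> at a time: the orthogonal
  complement of \<open>v\<close> in \<open>S\<close> is again invariant. Arbitrary subspaces are needed for this
  induction only.\<close>
lemma symmetric_eigenbasis_subspace:
  fixes f :: "'a::euclidean_space \<Rightarrow> 'a"
  assumes lin: "linear f" and sym: "\<And>x y. f x \<bullet> y = x \<bullet> f y"
  assumes "subspace S" "\<And>x. x \<in> S \<Longrightarrow> f x \<in> S"
  shows "\<exists>B\<subseteq>S. pairwise orthogonal B \<and> (\<forall>b\<in>B. norm b = 1 \<and> (\<exists>l. f b = l *\<^sub>R b)) \<and> span B = S"
  using assms(3,4)
proof (induction "dim S" arbitrary: S rule: less_induct)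
  case less
  show ?case
  proof (cases "S = {0}")
    case True
    then show ?thesis by (intro exI[of _ "{}"]) auto
  next
    case False
    obtain v l where v: "v \<in> S" "norm v = 1" "f v = l *\<^sub>R v"
      using symmetric_eigenvector_exists[OF lin sym less.prems False] by blast
    define T where "T = {x \<in> S. x \<bullet> v = 0}"
    have vv: "v \<bullet> v = 1" using v by (simp add: norm_eq_1)
    have T: "subspace T" using less.prems(1) by (auto simp: T_def subspace_def inner_add_left)
    have "f x \<in> T" if "x \<in> T" for x using that less.prems(2) v by (simp add: T_def sym)
    moreover have "dim T < dim S"
    proof (rule dim_psubset)
      show "span T \<subset> span S"
        unfolding span_eq_iff[THEN iffD2, OF T] span_eq_iff[THEN iffD2, OF less.prems(1)]
        using v vv by (force simp: T_def)
    qed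
    ultimately obtain B where B: "B \<subseteq> T" "pairwise orthogonal B"
        "\<forall>b\<in>B. norm b = 1 \<and> (\<exists>l. f b = l *\<^sub>R b)" "span B = T"
      using less.hyps T by meson
    have "S \<subseteq> span (insert v B)"
    proof
      fix x assume x: "x \<in> S"
      have "x - (x \<bullet> v) *\<^sub>R v \<in> T"
        using x v less.prems(1) vv by (simp add: T_def inner_diff_left subspace_diff subspace_scale)
      then show "x \<in> span (insert v B)" using B(4) span_insert by blast
    qed
    moreover have BS: "insert v B \<subseteq> S" using B(1) v by (auto simp: T_def)
    moreover have "span (insert v B) \<subseteq> S" using BS less.prems(1) by (simp add: span_minimal)
    moreover have "pairwise orthogonal (insert v B)"
      using B(1,2) by (auto simp: pairwise_insert orthogonal_def T_def inner_commute)
    ultimately show ?thesis using B(3) v by (intro exI[of _ "insert v B"]) auto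
  qed
qed

lemma symmetric_matrix_inner:
  fixes P :: "real ^ 'k ^ 'k"
  assumes "transpose P = P"
  shows "(P *v x) \<bullet> y = x \<bullet> (P *v y)"
  using assms by (metis dot_lmul_matrix vector_transpose_matrix)

lemma symmetric_matrix_eigenbasis:
  fixes P :: "real ^ 'k ^ 'k"
  assumes sym: "transpose P = P"
  obtains b :: "'k \<Rightarrow> real ^ 'k" and l :: "'k \<Rightarrow> real"
  where "\<And>i j. b i \<bullet> b j = (if i = j then 1 else 0)" "\<And>i. P *v b i = l i *\<^sub>R b i"
    "\<And>x. x = (\<Sum>i\<in>UNIV. (b i \<bullet> x) *\<^sub>R b i)"
proof -
  obtain B where B: "pairwise orthogonal B" "\<forall>b\<in>B. norm b = 1 \<and> (\<exists>l. P *v b = l *\<^sub>R b)" "span B = UNIV"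
    using symmetric_eigenbasis_subspace[of "(*v) P" UNIV] symmetric_matrix_inner[OF sym] by auto
  have "0 \<notin> B" using B(2) by force
  then have ind: "independent B" using B(1) pairwise_orthogonal_independent by blast
  have fin: "finite B" using ind independent_imp_finite by blast
  have "card B = CARD('k)"
    using dim_eq_card[of B UNIV] ind B(3) by (simp add: dim_UNIV)
  then obtain b where b: "bij_betw b (UNIV::'k set) B"
    by (metis fin finite bij_betw_iff_card)
  have bB: "b i \<in> B" for i using b by (auto simp: bij_betw_def)
  obtain l where l: "\<And>i. P *v b i = l i *\<^sub>R b i" 
  proof -
    have "\<forall>i. \<exists>l. P *v b i = l *\<^sub>R b i" using B(2) bB by blast
    then show ?thesis using that by metis
  qed
  have on: "b i \<bullet> b j = (if i = j then 1 else 0)" for i j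
  proof (cases "i = j")
    case True then show ?thesis using B(2) bB by (simp add: norm_eq_1[symmetric])
  next
    case False
    then have "b i \<noteq> b j" using b by (meson UNIV_I bij_betw_def inj_onD)
    then show ?thesis using B(1) bB False by (simp add: pairwise_def orthogonal_def)
  qed
  have "x = (\<Sum>i\<in>UNIV. (b i \<bullet> x) *\<^sub>R b i)" for x
  proof -
    define y where "y = x - (\<Sum>i\<in>UNIV. (b i \<bullet> x) *\<^sub>R b i)"
    have "b j \<bullet> y = 0" for j
      by (simp add: y_def inner_diff_right inner_sum_right on if_distrib cong: if_cong)
    then have "orthogonal y z" if "z \<in> B" for z
      using that b by (auto simp: orthogonal_def bij_betw_def inner_commute)
    then have "orthogonal y y" using B(3) orthogonal_to_span by blast
    then show ?thesis by (simp add: y_def orthogonal_self)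
  qed
  then show thesis using that on l by blast
qed

lemma matrix_mult_component: "(A ** B) $ i $ j = (\<Sum>k\<in>UNIV. A $ i $ k * B $ k $ j)"
  by (simp add: matrix_matrix_mult_def)

text \<open>The determinant of \<open>X - P\<close> is a determinant over the polynomial ring, so the diagonalisation
  is lifted to constant polynomials: \<open>(X - P) Q = Q D\<close> with \<open>D\<close> diagonal, and \<open>det Q\<close> cancels because
  \<open>Q\<close> is orthogonal.\<close>
lemma char_poly_of_eigenbasis:
  fixes P :: "real ^ 'k ^ 'k" and b :: "'k \<Rightarrow> real ^ 'k"
  assumes on: "\<And>i j. b i \<bullet> b j = (if i = j then 1 else 0)" and ev: "\<And>i. P *v b i = l i *\<^sub>R b i"
  shows "char_poly_matrix P = (\<Prod>i\<in>UNIV. [:- l i, 1:])"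
proof -
  define X :: "real poly ^ 'k ^ 'k" where "X = (\<chi> i j. (if i = j then [:0, 1:] else 0) - [:P $ i $ j:])"
  define Q :: "real poly ^ 'k ^ 'k" where "Q = (\<chi> i j. [:b j $ i:])"
  define D :: "real poly ^ 'k ^ 'k" where "D = (\<chi> i j. if i = j then [:- l i, 1:] else 0)"
  have sum_const: "(\<Sum>i\<in>UNIV. [:g i:]) = [:\<Sum>i\<in>UNIV. g i:]" for g :: "'k \<Rightarrow> real"
    by (simp add: poly_eq_iff coeff_sum coeff_pCons split: nat.splits)
  have "transpose Q ** Q = mat 1"
    using on by (simp add: vec_eq_iff matrix_mult_component transpose_def Q_def sum_const mat_def
        inner_vec_def)
  then have "det Q * det Q = 1" by (metis det_I det_mul det_transpose)
  then have nz: "det Q \<noteq> 0" by auto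
  have "(X ** Q) $ i $ j = (Q ** D) $ i $ j" for i j
  proof -
    have "(\<Sum>k\<in>UNIV. P $ i $ k * b j $ k) = l j * b j $ i"
      using ev[of j] by (simp add: vec_eq_iff matrix_vector_mult_def)
    moreover have "(X ** Q) $ i $ j = [:0, 1:] * [:b j $ i:] - [:\<Sum>k\<in>UNIV. P $ i $ k * b j $ k:]"
    proof -
      have "((if i = k then [:0, 1:] else 0) - [:P $ i $ k:]) * [:b j $ k:] =
          (if i = k then [:0, 1:] * [:b j $ k:] else 0) - [:P $ i $ k * b j $ k:]" for k
        by (auto simp: left_diff_distrib)
      then show ?thesis
        unfolding matrix_mult_component X_def Q_def
        by (simp add: sum_subtractf sum_const[symmetric] del: mult_pCons_left mult_pCons_right)
    qed
    moreover have "(Q ** D) $ i $ j = [:b j $ i:] * [:- l j, 1:]"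
      by (simp add: matrix_mult_component Q_def D_def if_distrib[of "\<lambda>x. _ * x"] cong: if_cong)
    ultimately show ?thesis by (simp add: algebra_simps)
  qed
  then have "X ** Q = Q ** D" by (simp add: vec_eq_iff)
  then have "det X * det Q = det D * det Q" by (metis det_mul mult.commute)
  then have "det X = det D" using nz by simp
  also have "det D = (\<Prod>i\<in>UNIV. [:- l i, 1:])" by (subst det_diagonal) (auto simp: D_def)
  finally show ?thesis by (simp add: char_poly_matrix_def X_def)
qed

text \<open>This translates the sorted list of roots in \<open>eigval_mag\<close> into what is needed of the second
  eigenvalue: all eigenvalues but one are at most as large in magnitude, and the remaining one is at
  least as large. Indexing by \<open>'k\<close> keeps track of multiplicities.\<close>
lemma second_eigenvalue_split:
  fixes P :: "real ^ 'k ^ 'k" and l :: "'k \<Rightarrow> real"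
  assumes card: "CARD('k) > 1"
  assumes cp: "char_poly_matrix P = (\<Prod>i\<in>UNIV. [:- l i, 1:])"
  obtains i0 where "\<bar>eigval_mag 2 P\<bar> \<le> \<bar>l i0\<bar>" "\<And>i. i \<noteq> i0 \<Longrightarrow> \<bar>l i\<bar> \<le> \<bar>eigval_mag 2 P\<bar>"
proof -
  define M where "M = image_mset l (mset_set UNIV)"
  define L where "L = sort_key abs (sorted_list_of_multiset M)"
  have pr: "proots (char_poly_matrix P) = M"
    unfolding cp M_def by (subst proots_prod) (auto simp: sum_unfold_sum_mset)
  have mL: "mset L = M" by (simp add: L_def)
  have len: "length L = CARD('k)" 
    using arg_cong[OF mL, of size] by (simp add: M_def)
  have sorted: "sorted (map abs L)" by (simp add: L_def)
  define k where "k = CARD('k) - 2"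
  have mu: "eigval_mag 2 P = L ! k"
    using card len by (simp add: eigval_mag_def pr L_def[symmetric] rev_nth k_def numeral_2_eq_2)
  have kl: "Suc k < length L" using card len by (simp add: k_def)
  \<comment> \<open>The sorted list \<open>L\<close> comes from a permutation \<open>p\<close> of an enumeration \<open>xs\<close> of the indices; the index of
    its last entry is the exceptional one.\<close>
  obtain xs where xs: "mset xs = mset_set (UNIV :: 'k set)" using ex_mset by blast
  have "mset L = mset (map l xs)" using mL xs by (simp add: M_def)
  from mset_eq_permutation[OF this]
  obtain p where p: "p permutes {..<length xs}" and Lp: "permute_list p (map l xs) = L"
    by auto
  have lx: "length xs = length L" using Lp by auto
  have nth: "L ! j = l (xs ! p j)" if "j < length L" for j
  proof -
    have j: "j < length xs" using that lx by simp
    then have "p j < length xs" using permutes_in_image[OF p, of j] by simp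
    then have "permute_list p (map l xs) ! j = l (xs ! p j)"
      using j p by (simp add: permute_list_nth)
    then show ?thesis by (simp only: Lp)
  qed
  have xs_UNIV: "set xs = UNIV" using xs by (metis finite finite_set_mset_mset_set set_mset_mset)
  have mono: "\<bar>L ! i\<bar> \<le> \<bar>L ! j\<bar>" if "i \<le> j" "j < length L" for i j
    using sorted_nth_mono[OF sorted, of i j] that by simp
  define i0 where "i0 = xs ! p (Suc k)"
  show thesis
  proof
    show "\<bar>eigval_mag 2 P\<bar> \<le> \<bar>l i0\<bar>"
      using mono[of k "Suc k"] kl nth[of "Suc k"] by (simp add: mu i0_def)
  next
    fix i assume i: "i \<noteq> i0"
    obtain j where j: "j < length xs" "xs ! j = i" using xs_UNIV by (metis UNIV_I in_set_conv_nth)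
    obtain j' where j': "j' < length xs" "p j' = j"
      using j(1) p by (metis (no_types, lifting) imageE lessThan_iff permutes_image)
    have "j' \<noteq> Suc k" using i j j' by (auto simp: i0_def)
    then have "j' \<le> k" using j' lx len card by (simp add: k_def)
    then show "\<bar>l i\<bar> \<le> \<bar>eigval_mag 2 P\<bar>"
      using mono[of j' k] kl nth[of j'] j j' lx by (simp add: mu)
  qed
qed

text \<open>In an eigenbasis, take for \<open>v\<close> the vector whose eigenvalue \<open>l\<close> was singled out above; the
  bounds are then Parseval's identity.\<close>
lemma symmetric_matrix_gap:
  fixes P :: "real ^ 'k ^ 'k"
  assumes card: "CARD('k) > 1" and sym: "transpose P = P"
  obtains v l where "norm v = 1" "P *v v = l *\<^sub>R v"
    "\<And>w. w \<bullet> v = 0 \<Longrightarrow> norm (P *v w) \<le> \<bar>eigval_mag 2 P\<bar> * norm w"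
    "\<And>w. norm (P *v w) \<le> \<bar>l\<bar> * norm w"
    "\<bar>eigval_mag 2 P\<bar> \<le> \<bar>l\<bar>"
proof -
  define m where "m = \<bar>eigval_mag 2 P\<bar>"
  obtain b :: "'k \<Rightarrow> real ^ 'k" and l :: "'k \<Rightarrow> real"
    where on: "\<And>i j. b i \<bullet> b j = (if i = j then 1 else 0)"
    and ev: "\<And>i. P *v b i = l i *\<^sub>R b i"
    and expand: "\<And>x. x = (\<Sum>i\<in>UNIV. (b i \<bullet> x) *\<^sub>R b i)"
    using symmetric_matrix_eigenbasis[OF sym] by blast
  obtain i0 where i0: "m \<le> \<bar>l i0\<bar>" "\<And>i. i \<noteq> i0 \<Longrightarrow> \<bar>l i\<bar> \<le> m"
    using second_eigenvalue_split[OF card char_poly_of_eigenbasis[OF on ev]] unfolding m_def by metis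
  have parseval: "(norm x)\<^sup>2 = (\<Sum>i\<in>UNIV. (b i \<bullet> x)\<^sup>2)" for x
  proof -
    have "(norm x)\<^sup>2 = x \<bullet> (\<Sum>i\<in>UNIV. (b i \<bullet> x) *\<^sub>R b i)"
      using expand[of x] by (simp add: power2_norm_eq_inner)
    then show ?thesis by (simp add: inner_sum_right inner_commute power2_eq_square)
  qed
  have coord: "b i \<bullet> (P *v x) = l i * (b i \<bullet> x)" for i x
    using symmetric_matrix_inner[OF sym, of "b i" x] by (simp add: ev)
  have bound: "norm (P *v w) \<le> c * norm w"
    if "c \<ge> 0" "\<And>i. \<bar>l i\<bar> \<le> c \<or> b i \<bullet> w = 0" for c w
  proof (rule power2_le_imp_le)
    have "(l i * (b i \<bullet> w))\<^sup>2 \<le> c\<^sup>2 * (b i \<bullet> w)\<^sup>2" for i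
    proof (cases "b i \<bullet> w = 0")
      case False
      then have "(l i)\<^sup>2 \<le> c\<^sup>2" using that(2)[of i] power_mono[of "\<bar>l i\<bar>" c 2] by simp
      then show ?thesis by (simp add: power_mult_distrib mult_right_mono)
    qed simp
    then show "(norm (P *v w))\<^sup>2 \<le> (c * norm w)\<^sup>2"
      by (simp add: power_mult_distrib parseval coord sum_distrib_left sum_mono)
  qed (use that in simp)
  show thesis
  proof
    show "norm (b i0) = 1" by (simp add: on norm_eq_1)
    show "P *v b i0 = l i0 *\<^sub>R b i0" by (rule ev)
    show "norm (P *v w) \<le> \<bar>eigval_mag 2 P\<bar> * norm w" if "w \<bullet> b i0 = 0" for w
      unfolding m_def[symmetric]
    proof (rule bound)
      fix i show "\<bar>l i\<bar> \<le> m \<or> b i \<bullet> w = 0"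
        using that i0(2)[of i] by (cases "i = i0") (auto simp: inner_commute)
    qed (simp add: m_def)
    show "norm (P *v w) \<le> \<bar>l i0\<bar> * norm w" for w
    proof (rule bound)
      fix i show "\<bar>l i\<bar> \<le> \<bar>l i0\<bar> \<or> b i \<bullet> w = 0"
        using i0(1) i0(2)[of i] by (cases "i = i0") auto
    qed simp
    show "\<bar>eigval_mag 2 P\<bar> \<le> \<bar>l i0\<bar>" using i0(1) by (simp add: m_def)
  qed
qed

section \<open>The bilinear form of \<open>P\<close> on vectors with sum zero\<close>

text \<open>Schur's test with the positive weight vector \<open>h\<close>: by the inequality of arithmetic and geometric
  means, \<open>2 \<bar>x\<^sub>k x\<^sub>l\<bar> \<le> x\<^sub>k\<^sup>2 h\<^sub>l / h\<^sub>k + x\<^sub>l\<^sup>2 h\<^sub>k / h\<^sub>l\<close>, and the row sums of \<open>P\<close> weighted by \<open>h\<close> all equal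
  \<open>q\<close>. It replaces the Perron-Frobenius theorem here, as it bounds every eigenvalue by \<open>q / C\<close>.\<close>
lemma schur_test:
  fixes P :: "real ^ 'k ^ 'k"
  assumes sym: "transpose P = P" and nonneg: "\<And>k l. P $ k $ l \<ge> 0"
    and Ph: "P *v h = q *\<^sub>R vec 1" and C: "C > 0" "\<And>k. h $ k \<ge> C"
  shows "\<bar>x \<bullet> (P *v x)\<bar> \<le> q / C * (norm x)\<^sup>2"
proof -
  have hpos: "h $ k > 0" for k using C(2)[of k] C(1) by linarith
  have row: "(\<Sum>l\<in>UNIV. P $ k $ l * h $ l) = q" for k
    using Ph by (simp add: vec_eq_iff matrix_vector_mult_def)
  have Psym: "P $ k $ l = P $ l $ k" for k l
    using sym by (metis transpose_def vec_lambda_beta)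
  have amgm: "\<bar>x $ k * x $ l\<bar> \<le> ((x $ k)\<^sup>2 * h $ l / h $ k + (x $ l)\<^sup>2 * h $ k / h $ l) / 2" for k l
  proof -
    have "0 \<le> (\<bar>x $ k\<bar> * h $ l - \<bar>x $ l\<bar> * h $ k)\<^sup>2" by simp
    then have "2 * \<bar>x $ k * x $ l\<bar> * (h $ k * h $ l) \<le> (x $ k)\<^sup>2 * (h $ l)\<^sup>2 + (x $ l)\<^sup>2 * (h $ k)\<^sup>2"
      by (simp add: power2_diff power_mult_distrib abs_mult mult_ac)
    then show ?thesis using hpos[of k] hpos[of l] by (simp add: field_simps power2_eq_square)
  qed
  have qpos: "q \<ge> 0"
    using row[of undefined] sum_nonneg[of UNIV "\<lambda>l. P $ undefined $ l * h $ l"] nonneg hpos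
    by (simp add: less_imp_le)
  have "\<bar>x \<bullet> (P *v x)\<bar> = \<bar>\<Sum>k\<in>UNIV. \<Sum>l\<in>UNIV. P $ k $ l * (x $ k * x $ l)\<bar>"
    by (simp add: inner_vec_def matrix_vector_mult_def sum_distrib_left mult_ac)
  also have "\<dots> \<le> (\<Sum>k\<in>UNIV. \<Sum>l\<in>UNIV. P $ k $ l * \<bar>x $ k * x $ l\<bar>)"
    using nonneg by (auto intro!: order.trans[OF sum_abs] sum_mono simp: abs_mult)
  also have "\<dots> \<le> (\<Sum>k\<in>UNIV. \<Sum>l\<in>UNIV. P $ k $ l *
        (((x $ k)\<^sup>2 * h $ l / h $ k + (x $ l)\<^sup>2 * h $ k / h $ l) / 2))"
    using nonneg amgm by (intro sum_mono mult_left_mono)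
  also have "\<dots> = ((\<Sum>k\<in>UNIV. \<Sum>l\<in>UNIV. (x $ k)\<^sup>2 / h $ k * (P $ k $ l * h $ l)) +
        (\<Sum>k\<in>UNIV. \<Sum>l\<in>UNIV. (x $ l)\<^sup>2 / h $ l * (P $ l $ k * h $ k))) / 2"
  proof -
    have "P $ k $ l * (((x $ k)\<^sup>2 * h $ l / h $ k + (x $ l)\<^sup>2 * h $ k / h $ l) / 2) =
      ((x $ k)\<^sup>2 / h $ k * (P $ k $ l * h $ l) + (x $ l)\<^sup>2 / h $ l * (P $ l $ k * h $ k)) / 2" for k l
      by (simp add: Psym[of l k] algebra_simps add_divide_distrib)
    then show ?thesis by (simp add: sum.distrib sum_divide_distrib[symmetric])
  qed
  also have "(\<Sum>k\<in>UNIV. \<Sum>l\<in>UNIV. (x $ l)\<^sup>2 / h $ l * (P $ l $ k * h $ k)) =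
      (\<Sum>k\<in>UNIV. \<Sum>l\<in>UNIV. (x $ k)\<^sup>2 / h $ k * (P $ k $ l * h $ l))"
    by (rule sum.swap)
  also have "(\<Sum>k\<in>UNIV. \<Sum>l\<in>UNIV. (x $ k)\<^sup>2 / h $ k * (P $ k $ l * h $ l)) = q * (\<Sum>k\<in>UNIV. (x $ k)\<^sup>2 / h $ k)"
    by (simp only: sum_distrib_left[symmetric] row sum_distrib_right[symmetric] mult.commute[of q])
  also have "(q * (\<Sum>k\<in>UNIV. (x $ k)\<^sup>2 / h $ k) + q * (\<Sum>k\<in>UNIV. (x $ k)\<^sup>2 / h $ k)) / 2 =
      q * (\<Sum>k\<in>UNIV. (x $ k)\<^sup>2 / h $ k)" by simp
  also have "\<dots> \<le> q * (\<Sum>k\<in>UNIV. (x $ k)\<^sup>2 / C)"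
    using C qpos by (intro mult_left_mono sum_mono divide_left_mono) (auto simp: hpos)
  also have "\<dots> = q / C * (norm x)\<^sup>2"
    by (simp only: power2_norm_eq_inner, simp add: inner_vec_def sum_divide_distrib[symmetric] power2_eq_square)
  finally show ?thesis .
qed

lemma norm_prob_simplex_le_1: "x \<in> prob_simplex \<Longrightarrow> norm x \<le> 1"
  using norm_le_l1_cart[of x] by (auto simp: prob_simplex_def)

text \<open>Decompose \<open>h = a v + w\<close> along the leading eigenvector \<open>v\<close>, with eigenvalue \<open>l\<close>. Pairing
  \<open>P h = q 1\<close> with \<open>y\<close> gives \<open>a l (v \<bullet> y) = - P w \<bullet> y\<close>, which is at most \<open>\<bar>\<mu>\<^sub>2\<bar> \<parallel>y\<parallel>\<close> in magnitude; so
  the leading part \<open>l (v \<bullet> y) (v \<bullet> z)\<close> of the form is at most \<open>\<mu>\<^sub>2\<^sup>2 / (a\<^sup>2 \<bar>l\<bar>) \<le> \<bar>\<mu>\<^sub>2\<bar> / a\<^sup>2\<close> times the norms.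
  This is good enough unless \<open>a\<close> is small. But if \<open>\<bar>a\<bar> \<le> C\<close>, then the leading eigenvector carries too
  little of \<open>h\<close> to produce \<open>q 1\<close>, whose norm is at least \<open>sqrt 2 q\<close>. Then \<open>q \<le> \<bar>\<mu>\<^sub>2\<bar>\<close>, and Schur's
  test bounds the whole form.\<close>
lemma bilinear_bound_sum_zero:
  fixes P :: "real ^ 'k ^ 'k"
  assumes card: "CARD('k) > 1" and sym: "transpose P = P" and nonneg: "\<And>k l. P $ k $ l \<ge> 0"
    and Ph: "P *v h = q *\<^sub>R vec 1" and h: "h \<in> prob_simplex"
    and C: "C > 0" "\<And>k. h $ k \<ge> C"
    and y: "y \<bullet> vec 1 = 0" and z: "z \<bullet> vec 1 = 0"
  shows "\<bar>y \<bullet> (P *v z)\<bar> \<le> (1 + 1 / C\<^sup>2) * \<bar>eigval_mag 2 P\<bar> * (norm y * norm z)"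
proof -
  define m where "m = \<bar>eigval_mag 2 P\<bar>"
  obtain v l where v: "norm v = 1" "P *v v = l *\<^sub>R v"
    and gap: "\<And>w. w \<bullet> v = 0 \<Longrightarrow> norm (P *v w) \<le> m * norm w"
    and opn: "\<And>w. norm (P *v w) \<le> \<bar>l\<bar> * norm w" and ml: "m \<le> \<bar>l\<bar>"
    using symmetric_matrix_gap[OF card sym] unfolding m_def by blast
  have m0: "m \<ge> 0" by (simp add: m_def)
  have vv: "v \<bullet> v = 1" using v(1) by (simp add: norm_eq_1)
  have N0: "norm y * norm z \<ge> 0" by simp
  have C1: "C \<le> 1"
  proof -
    have "h $ k \<le> 1" for k
      using norm_prob_simplex_le_1[OF h] component_le_norm_cart[of h k] by linarith
    then show ?thesis using C(2) order.trans by blast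
  qed
  have lq: "\<bar>l\<bar> \<le> q / C"
    using schur_test[OF sym nonneg Ph C, of v] v vv by simp
  define a where "a = h \<bullet> v"
  define w where "w = h - a *\<^sub>R v"
  have wv: "w \<bullet> v = 0" by (simp add: w_def a_def inner_diff_left vv)
  have hw: "h = a *\<^sub>R v + w" by (simp add: w_def)
  have "(norm h)\<^sup>2 = a\<^sup>2 + (norm w)\<^sup>2"
    using wv vv by (subst hw) (simp only: power2_norm_eq_inner, simp add: inner_add_left inner_add_right inner_commute power2_eq_square)
  moreover have "(norm h)\<^sup>2 \<le> 1"
    using norm_prob_simplex_le_1[OF h] by (simp add: power_le_one)
  ultimately have "(norm w)\<^sup>2 \<le> 1" using zero_le_power2[of a] by linarith
  then have w1: "norm w \<le> 1" by (simp add: power_le_one_iff)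
  have Pw: "norm (P *v w) \<le> m" using gap[OF wv] w1 m0 by (meson mult_left_le order.trans)
  have Phw: "q *\<^sub>R vec 1 = (a * l) *\<^sub>R v + P *v w"
    unfolding Ph[symmetric] by (subst hw) (simp add: matrix_vector_right_distrib v matrix_vector_mult_scaleR)
  have symw: "(P *v w) \<bullet> v = 0" using symmetric_matrix_inner[OF sym, of w v] v wv by simp
  show ?thesis
  proof (cases "a\<^sup>2 \<le> C\<^sup>2")
    case True
    have "(norm (q *\<^sub>R (vec 1 :: real ^ 'k)))\<^sup>2 = (a * l)\<^sup>2 + (norm (P *v w))\<^sup>2"
      unfolding Phw using symw vv
      by (simp only: power2_norm_eq_inner, simp add: inner_add_left inner_add_right inner_commute power2_eq_square)
    moreover have "(norm (q *\<^sub>R (vec 1 :: real ^ 'k)))\<^sup>2 = q\<^sup>2 * CARD('k)"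
      by (simp only: power2_norm_eq_inner, simp add: inner_vec_def power2_eq_square)
    moreover have "(a * l)\<^sup>2 \<le> q\<^sup>2"
    proof -
      have "(a * l)\<^sup>2 \<le> C\<^sup>2 * (q / C)\<^sup>2"
        unfolding power_mult_distrib using True power_mono[OF lq, of 2]
        by (intro mult_mono) auto
      then show ?thesis using C by (simp add: power_divide)
    qed
    moreover have "(norm (P *v w))\<^sup>2 \<le> m\<^sup>2" using Pw by (simp add: power_mono)
    moreover have "q\<^sup>2 * 2 \<le> q\<^sup>2 * CARD('k)" using card by (intro mult_left_mono) auto
    ultimately have "q\<^sup>2 \<le> m\<^sup>2" by linarith
    then have qm: "q \<le> m" using m0 by (rule power2_le_imp_le)
    have "\<bar>y \<bullet> (P *v z)\<bar> \<le> norm y * norm (P *v z)" by (rule Cauchy_Schwarz_ineq2)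
    also have "\<dots> \<le> norm y * (\<bar>l\<bar> * norm z)"
      using opn[of z] by (intro mult_left_mono) auto
    also have "\<dots> = \<bar>l\<bar> * (norm y * norm z)" by simp
    also have "\<bar>l\<bar> \<le> m / C" using lq qm C by (meson divide_right_mono less_imp_le order.trans)
    also have "m / C \<le> (1 + 1 / C\<^sup>2) * m"
    proof -
      have "1 / C \<le> 1 / C\<^sup>2" using C C1 by (intro divide_left_mono) (auto simp: power2_eq_square mult_le_one mult_left_le)
      then have "m * (1 / C) \<le> m * (1 + 1 / C\<^sup>2)" using m0 by (intro mult_left_mono) auto
      then show ?thesis by (simp add: mult.commute)
    qed
    finally show ?thesis using N0 by (simp add: mult_right_mono m_def)
  next
    case False
    then have a2: "C\<^sup>2 < a\<^sup>2" by simp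
    define yv where "yv = y \<bullet> v"
    define zv where "zv = z \<bullet> v"
    define y' where "y' = y - yv *\<^sub>R v"
    define z' where "z' = z - zv *\<^sub>R v"
    have z'v: "z' \<bullet> v = 0" by (simp add: z'_def zv_def inner_diff_left vv)
    have y'v: "y' \<bullet> v = 0" by (simp add: y'_def yv_def inner_diff_left vv)
    have pyth: "norm (x - (x \<bullet> v) *\<^sub>R v) \<le> norm x" for x
    proof (rule power2_le_imp_le)
      show "(norm (x - (x \<bullet> v) *\<^sub>R v))\<^sup>2 \<le> (norm x)\<^sup>2"
        by (simp only: power2_norm_eq_inner, simp add: inner_diff_left inner_diff_right inner_commute vv)
    qed simp
    have nz': "norm z' \<le> norm z" and ny': "norm y' \<le> norm y"
      unfolding z'_def y'_def zv_def yv_def by (rule pyth)+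
    have dec: "y \<bullet> (P *v z) = l * (yv * zv) + y' \<bullet> (P *v z')"
    proof -
      have z: "z = zv *\<^sub>R v + z'" by (simp add: z'_def)
      have "P *v z = (zv * l) *\<^sub>R v + P *v z'"
        by (subst z) (simp add: matrix_vector_right_distrib matrix_vector_mult_scaleR v)
      moreover have "v \<bullet> (P *v z') = 0"
        using symmetric_matrix_inner[OF sym, of v z'] v z'v by (simp add: inner_commute)
      ultimately show ?thesis by (simp add: y'_def inner_add_right inner_diff_left yv_def[symmetric])
    qed
    have rest: "\<bar>y' \<bullet> (P *v z')\<bar> \<le> m * (norm y * norm z)"
    proof -
      have "\<bar>y' \<bullet> (P *v z')\<bar> \<le> norm y' * norm (P *v z')" by (rule Cauchy_Schwarz_ineq2)
      also have "\<dots> \<le> norm y * (m * norm z)"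
        using gap[OF z'v] ny' nz' m0 by (intro mult_mono) (auto intro: order.trans mult_left_mono)
      finally show ?thesis by (simp add: mult_ac)
    qed
    have orth: "a * l * (x \<bullet> v) = - ((P *v w) \<bullet> x)" if "x \<bullet> vec 1 = 0" for x
      using arg_cong[OF Phw, of "\<lambda>u. x \<bullet> u"] that by (simp add: inner_add_right inner_commute)
    have small: "\<bar>a * l * (x \<bullet> v)\<bar> \<le> m * norm x" if "x \<bullet> vec 1 = 0" for x
      unfolding orth[OF that] using Cauchy_Schwarz_ineq2[of "P *v w" x] Pw mult_right_mono[of "norm (P *v w)" m "norm x"] by simp
    have lead: "\<bar>l * (yv * zv)\<bar> \<le> m / C\<^sup>2 * (norm y * norm z)"
    proof (cases "l = 0")
      case False
      have "\<bar>a * l * yv\<bar> * \<bar>a * l * zv\<bar> \<le> (m * norm y) * (m * norm z)"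
        unfolding yv_def zv_def using m0 by (intro mult_mono small y z) auto
      also have "\<dots> \<le> \<bar>l\<bar> * (m * (norm y * norm z))"
        using mult_right_mono[OF ml, of "m * (norm y * norm z)"] m0 by (simp add: mult_ac)
      also have "\<bar>a * l * yv\<bar> * \<bar>a * l * zv\<bar> = \<bar>l\<bar> * (\<bar>a\<bar>\<^sup>2 * \<bar>l * (yv * zv)\<bar>)"
        by (simp only: abs_mult power2_eq_square mult_ac)
      finally have "\<bar>l\<bar> * (a\<^sup>2 * \<bar>l * (yv * zv)\<bar>) \<le> \<bar>l\<bar> * (m * (norm y * norm z))"
        by (simp only: power2_abs)
      then have "a\<^sup>2 * \<bar>l * (yv * zv)\<bar> \<le> m * (norm y * norm z)" using False by simp
      moreover have "C\<^sup>2 * \<bar>l * (yv * zv)\<bar> \<le> a\<^sup>2 * \<bar>l * (yv * zv)\<bar>"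
        using a2 by (intro mult_right_mono) auto
      ultimately have "C\<^sup>2 * \<bar>l * (yv * zv)\<bar> \<le> m * (norm y * norm z)" by linarith
      then show ?thesis using C by (simp add: field_simps)
    qed (use m0 in simp)
    have "\<bar>y \<bullet> (P *v z)\<bar> \<le> m / C\<^sup>2 * (norm y * norm z) + m * (norm y * norm z)"
      unfolding dec using lead rest by linarith
    also have "\<dots> = (1 + 1 / C\<^sup>2) * m * (norm y * norm z)" by (simp add: algebra_simps)
    finally show ?thesis by (simp add: m_def)
  qed
qed

lemma prob_simplex_inner_one: "x \<in> prob_simplex \<Longrightarrow> x \<bullet> 1 = 1"
  by (simp add: prob_simplex_def inner_vec_def)

text \<open>The cross terms on the right-hand side are constants, because \<open>P h = q 1\<close> and the coordinates
  of \<open>x\<close>, \<open>z\<close> and \<open>h\<close> sum to one.\<close>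
lemma affinity_deviation:
  fixes P :: "real ^ 'k ^ 'k"
  assumes sym: "transpose P = P" and Ph: "P *v h = q *\<^sub>R vec 1"
    and h: "h \<in> prob_simplex" and x: "x \<in> prob_simplex" and z: "z \<in> prob_simplex"
  shows "x \<bullet> (P *v z) - q = (x - h) \<bullet> (P *v (z - h))"
proof -
  have "h \<bullet> (P *v z) = q" using symmetric_matrix_inner[OF sym, of h z] Ph prob_simplex_inner_one[OF z]
    by (simp add: inner_commute)
  then show ?thesis
    using prob_simplex_inner_one[OF x] prob_simplex_inner_one[OF h] Ph
    by (simp add: matrix_vector_mult_diff_distrib inner_diff_left inner_diff_right)
qed

text \<open>Differences of two points of the simplex have sum zero and norm at most \<open>2\<close>, which gives the
  factor \<open>4\<close>.\<close>
lemma affinity_deviation_bound: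
  fixes P :: "real ^ 'k ^ 'k"
  assumes "CARD('k) > 1" "transpose P = P" "\<And>k l. P $ k $ l \<ge> 0"
    and "P *v h = q *\<^sub>R vec 1" and h: "h \<in> prob_simplex"
    and "C > 0" "\<And>k. h $ k \<ge> C"
    and x: "x \<in> prob_simplex" and z: "z \<in> prob_simplex"
  shows "\<bar>x \<bullet> (P *v z) - q\<bar> \<le> 4 * (1 + 1 / C\<^sup>2) * \<bar>eigval_mag 2 P\<bar>"
proof -
  have n: "norm (u - h) \<le> 2" if "u \<in> prob_simplex" for u
    using norm_triangle_ineq4[of u h] norm_prob_simplex_le_1[OF that] norm_prob_simplex_le_1[OF h] by linarith
  have o: "(u - h) \<bullet> vec 1 = 0" if "u \<in> prob_simplex" for u
    using that h by (simp add: inner_diff_left prob_simplex_inner_one)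
  have "\<bar>x \<bullet> (P *v z) - q\<bar> \<le> (1 + 1 / C\<^sup>2) * \<bar>eigval_mag 2 P\<bar> * (norm (x - h) * norm (z - h))"
    unfolding affinity_deviation[OF assms(2,4) h x z]
    by (rule bilinear_bound_sum_zero[OF assms(1-7) o[OF x] o[OF z]])
  also have "\<dots> \<le> (1 + 1 / C\<^sup>2) * \<bar>eigval_mag 2 P\<bar> * 4"
    using n[OF x] n[OF z] mult_mono[of "norm (x - h)" 2 "norm (z - h)" 2] by (intro mult_left_mono) auto
  finally show ?thesis by (simp only: mult_ac)
qed

section \<open>Orthogonal expansion over subgraphs\<close>

text \<open>Subsets of \<open>D\<close> stand for Boolean assignments on \<open>D\<close>. The same identity serves to sum over all
  graphs, to expand a product over edges, and to take means over independent two-valued variables.\<close>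
lemma sum_Pow_prod:
  fixes w :: "'e \<Rightarrow> bool \<Rightarrow> 'b :: comm_semiring_1"
  assumes "finite D"
  shows "(\<Sum>X\<in>Pow D. \<Prod>e\<in>D. w e (e \<in> X)) = (\<Prod>e\<in>D. w e True + w e False)"
proof -
  have "(\<Prod>e\<in>D. w e (e \<in> X)) = (\<Prod>e\<in>X. w e True) * (\<Prod>e\<in>D - X. w e False)" if "X \<in> Pow D" for X
  proof -
    have "X \<subseteq> D" using that by auto
    then have "(\<Prod>e\<in>D. w e (e \<in> X)) = (\<Prod>e\<in>D - X. w e (e \<in> X)) * (\<Prod>e\<in>X. w e (e \<in> X))"
      using assms by (rule prod.subset_diff)
    also have "\<dots> = (\<Prod>e\<in>D - X. w e False) * (\<Prod>e\<in>X. w e True)"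
      by (intro arg_cong2[of _ _ _ _ "(*)"] prod.cong) auto
    finally show ?thesis by (simp add: mult.commute)
  qed
  then show ?thesis by (simp add: prod_add[OF assms])
qed

definition bern :: "real \<Rightarrow> bool \<Rightarrow> real" where
  "bern x b = (if b then x else 1 - x)"

text \<open>The functions \<open>\<psi> G\<close> divided by the null likelihood are orthogonal under the null law, since
  \<open>\<psi> G A * \<psi> H A / \<Prod> bern\<close> factorises over the edges and an edge in exactly one of \<open>G\<close> and \<open>H\<close>
  contributes \<open>1 + (-1) = 0\<close>. An edge in both contributes \<open>1 / p + 1 / (1 - p) = 1 / (p (1 - p))\<close>.\<close>
lemma chi_square_orthogonality:
  fixes p :: "'e \<Rightarrow> real" and c :: "'e set \<Rightarrow> real"
  assumes D: "finite D" and p: "\<And>e. e \<in> D \<Longrightarrow> 0 < p e \<and> p e < 1"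
  defines "\<psi> \<equiv> \<lambda>G A. \<Prod>e\<in>D. if e \<in> G then (if e \<in> A then 1 else -1) else bern (p e) (e \<in> A)"
  shows "(\<Sum>A\<in>Pow D. (\<Sum>G\<in>Pow D. c G * \<psi> G A)\<^sup>2 / (\<Prod>e\<in>D. bern (p e) (e \<in> A)))
       = (\<Sum>G\<in>Pow D. (c G)\<^sup>2 * (\<Prod>e\<in>G. 1 / (p e * (1 - p e))))"
proof -
  define w where "w = (\<lambda>G e b. if e \<in> G then (if b then 1 else -1 :: real) else bern (p e) b)"
  have inner: "(\<Sum>A\<in>Pow D. \<psi> G A * \<psi> H A / (\<Prod>e\<in>D. bern (p e) (e \<in> A))) =
      (if G = H then \<Prod>e\<in>G. 1 / (p e * (1 - p e)) else 0)" if GH: "G \<in> Pow D" "H \<in> Pow D" for G H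
  proof -
    have "(\<Sum>A\<in>Pow D. \<psi> G A * \<psi> H A / (\<Prod>e\<in>D. bern (p e) (e \<in> A))) =
        (\<Sum>A\<in>Pow D. \<Prod>e\<in>D. w G e (e \<in> A) * w H e (e \<in> A) / bern (p e) (e \<in> A))"
      by (simp add: \<psi>_def w_def prod.distrib prod_dividef)
    also have "\<dots> = (\<Prod>e\<in>D. w G e True * w H e True / bern (p e) True + w G e False * w H e False / bern (p e) False)"
      by (rule sum_Pow_prod[OF D])
    also have "\<dots> = (\<Prod>e\<in>D. if e \<in> G then (if e \<in> H then 1 / (p e * (1 - p e)) else 0) else (if e \<in> H then 0 else 1))"
    proof (rule prod.cong[OF refl])
      fix e assume "e \<in> D"
      then have "p e \<noteq> 0" "1 - p e \<noteq> 0" using p by fastforce+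
      then show "w G e True * w H e True / bern (p e) True + w G e False * w H e False / bern (p e) False =
        (if e \<in> G then (if e \<in> H then 1 / (p e * (1 - p e)) else 0) else (if e \<in> H then 0 else 1))"
        by (auto simp: w_def bern_def field_simps)
    qed
    also have "\<dots> = (if G = H then \<Prod>e\<in>G. 1 / (p e * (1 - p e)) else 0)"
    proof (cases "G = H")
      case True
      have "(\<Prod>e\<in>D. if e \<in> G then 1 / (p e * (1 - p e)) else 1) = (\<Prod>e\<in>D \<inter> G. 1 / (p e * (1 - p e)))"
        using D by (simp add: prod.inter_restrict)
      moreover have "D \<inter> G = G" using GH by auto
      moreover have "(\<Prod>e\<in>D. if e \<in> G then (if e \<in> G then 1 / (p e * (1 - p e)) else 0) else (if e \<in> G then 0 else 1))
        = (\<Prod>e\<in>D. if e \<in> G then 1 / (p e * (1 - p e)) else 1)" by (intro prod.cong) auto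
      ultimately show ?thesis unfolding True[symmetric] by simp
    next
      case False
      then obtain e where "e \<in> D" "(e \<in> G) \<noteq> (e \<in> H)" using GH by blast
      then show ?thesis using D False by (auto intro!: prod_zero bexI[of _ e])
    qed
    finally show ?thesis .
  qed
  have "(\<Sum>A\<in>Pow D. (\<Sum>G\<in>Pow D. c G * \<psi> G A)\<^sup>2 / (\<Prod>e\<in>D. bern (p e) (e \<in> A))) =
     (\<Sum>A\<in>Pow D. \<Sum>G\<in>Pow D. \<Sum>H\<in>Pow D. c G * c H * (\<psi> G A * \<psi> H A / (\<Prod>e\<in>D. bern (p e) (e \<in> A))))"
    by (simp add: power2_eq_square sum_product sum_divide_distrib mult_ac)
  also have "\<dots> = (\<Sum>G\<in>Pow D. \<Sum>H\<in>Pow D. \<Sum>A\<in>Pow D. c G * c H * (\<psi> G A * \<psi> H A / (\<Prod>e\<in>D. bern (p e) (e \<in> A))))"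
    by (rule trans[OF sum.swap]) (rule sum.cong[OF refl], rule sum.swap)
  also have "\<dots> = (\<Sum>G\<in>Pow D. \<Sum>H\<in>Pow D. c G * c H * (if G = H then \<Prod>e\<in>G. 1 / (p e * (1 - p e)) else 0))"
    by (intro sum.cong[OF refl]) (simp only: inner sum_distrib_left[symmetric])
  also have "\<dots> = (\<Sum>G\<in>Pow D. (c G)\<^sup>2 * (\<Prod>e\<in>G. 1 / (p e * (1 - p e))))"
    using D by (intro sum.cong[OF refl])
      (simp add: if_distrib[of "\<lambda>x. _ * x"] sum.delta power2_eq_square cong: if_cong)
  finally show ?thesis .
qed

section \<open>Sums over graphs without leaves\<close>

definition node_degree :: "(nat \<times> nat) set \<Rightarrow> nat \<Rightarrow> nat" where
  "node_degree G i = card {e \<in> G. fst e = i \<or> snd e = i}"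

definition edges :: "nat \<Rightarrow> (nat \<times> nat) set" where
  "edges n = {(i, j). i < j \<and> j < n}"

lemma finite_edges [simp]: "finite (edges n)"
  by (rule finite_subset[of _ "{..<n} \<times> {..<n}"]) (auto simp: edges_def)

lemma prod_edges_eq_prod_degree:
  fixes f :: "nat \<Rightarrow> 'b :: comm_monoid_mult"
  assumes "G \<subseteq> edges n"
  shows "(\<Prod>e\<in>G. f (fst e) * f (snd e)) = (\<Prod>i<n. f i ^ node_degree G i)"
proof -
  have fin: "finite G" using assms finite_edges finite_subset by blast
  have "(\<Prod>e\<in>G. f (fst e) * f (snd e)) = (\<Prod>e\<in>G. \<Prod>i<n. if fst e = i \<or> snd e = i then f i else 1)"
  proof (rule prod.cong[OF refl])
    fix e assume "e \<in> G"
    then have e: "fst e < snd e" "snd e < n" using assms by (auto simp: edges_def)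
    have "(\<Prod>i<n. if fst e = i \<or> snd e = i then f i else 1) = (\<Prod>i\<in>{i\<in>{..<n}. fst e = i \<or> snd e = i}. f i)"
      by (rule prod.inter_filter[symmetric]) simp
    also have "{i\<in>{..<n}. fst e = i \<or> snd e = i} = {fst e, snd e}" using e by auto
    also have "(\<Prod>i\<in>{fst e, snd e}. f i) = f (fst e) * f (snd e)" using e by simp
    finally show "f (fst e) * f (snd e) = (\<Prod>i<n. if fst e = i \<or> snd e = i then f i else 1)" by simp
  qed
  also have "\<dots> = (\<Prod>i<n. \<Prod>e\<in>G. if fst e = i \<or> snd e = i then f i else 1)"
    by (rule prod.swap)
  also have "\<dots> = (\<Prod>i<n. f i ^ node_degree G i)"
    using fin by (simp add: prod.inter_filter[symmetric] node_degree_def)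
  finally show ?thesis .
qed

text \<open>The moments of the variable that is \<open>2\<close> with probability \<open>1/3\<close> and \<open>-1\<close> with probability
  \<open>2/3\<close>. It is skew because all moments beyond the mean, the odd ones included, have to be at least
  one.\<close>
definition skew_moment :: "nat \<Rightarrow> real" where
  "skew_moment d = 1 / 3 * 2 ^ d + 2 / 3 * (-1) ^ d"

lemma skew_moment_ge_1:
  assumes "d \<noteq> 1"
  shows "skew_moment d \<ge> 1"
proof (cases "d = 0")
  case False
  then have "d \<ge> 2" using assms by linarith
  have p: "(4::real) \<le> 2 ^ d" using power_increasing[OF \<open>d \<ge> 2\<close>, of "2::real"] by simp
  show ?thesis
  proof (cases "even d")
    case True then show ?thesis using p by (simp add: skew_moment_def)
  next
    case odd: False
    then have "d \<ge> 3" using \<open>d \<ge> 2\<close> by (cases "d = 2") auto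
    from power_increasing[OF this, of "2::real"] show ?thesis using odd by (simp add: skew_moment_def)
  qed
qed (simp add: skew_moment_def)

lemma skew_moment_1: "skew_moment 1 = 0"
  by (simp add: skew_moment_def)

text \<open>Hoeffding's lemma for a variable with mean zero on an interval of length \<open>3\<close>. As \<open>Hoeffdings_lemma_aux\<close>
  is about nonnegative exponents, negative ones are reduced to it by reflecting the
  variable, which exchanges the weights \<open>1/3\<close> and \<open>2/3\<close>.\<close>
lemma skew_mgf: "1 / 3 * exp (2 * t) + 2 / 3 * exp (- t) \<le> exp (9 / 8 * t\<^sup>2)" for t :: real
proof -
  have A: "exp (- h * p) * (1 + p * (exp h - 1)) \<le> exp (h\<^sup>2 / 8)"
    if "h \<ge> 0" "0 \<le> p" "p \<le> 1" for h p :: real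
  proof -
    have "1 \<le> exp h" using that by simp
    then have pos: "1 + p * (exp h - 1) > 0" using that by (smt (verit) mult_nonneg_nonneg)
    have "exp (- h * p + ln (1 + p * (exp h - 1))) \<le> exp (h\<^sup>2 / 8)"
      using Hoeffdings_lemma_aux[OF that(1,2)] by simp
    then show ?thesis using pos by (simp only: exp_add exp_ln)
  qed
  show ?thesis
  proof (cases "t \<ge> 0")
    case True
    have "1 / 3 * exp (2 * t) + 2 / 3 * exp (- t) = exp (- (3 * t) * (1/3)) * (1 + 1/3 * (exp (3 * t) - 1))"
      by (simp add: field_simps mult_exp_exp)
    also have "\<dots> \<le> exp ((3 * t)\<^sup>2 / 8)" using True by (intro A) auto
    finally show ?thesis by (simp add: power_mult_distrib)
  next
    case False
    have "1 / 3 * exp (2 * t) + 2 / 3 * exp (- t) = exp (- (-3 * t) * (2/3)) * (1 + 2/3 * (exp (-3 * t) - 1))"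
      by (simp add: field_simps mult_exp_exp)
    also have "\<dots> \<le> exp ((-3 * t)\<^sup>2 / 8)" using False by (intro A) auto
    finally show ?thesis by (simp add: power_mult_distrib)
  qed
qed

lemma gaussian_mgf:
  shows "integrable lborel (\<lambda>z. normal_density 0 1 z * exp (c * z))"
    and "(\<integral>z. normal_density 0 1 z * exp (c * z) \<partial>lborel) = exp (c\<^sup>2 / 2)"
proof -
  have eq: "normal_density 0 1 z * exp (c * z) = exp (c\<^sup>2 / 2) * normal_density c 1 z" for z
    by (simp add: normal_density_def mult_exp_exp field_simps power2_diff)
  show "integrable lborel (\<lambda>z. normal_density 0 1 z * exp (c * z))"
    unfolding eq by (simp add: integrable_normal_density)
  show "(\<integral>z. normal_density 0 1 z * exp (c * z) \<partial>lborel) = exp (c\<^sup>2 / 2)"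
    unfolding eq by (simp add: integral_normal_density)
qed

lemma gaussian_quadratic_mgf:
  assumes "2 * a < 1"
  shows "integrable lborel (\<lambda>z. normal_density 0 1 z * exp (a * z\<^sup>2))"
    and "(\<integral>z. normal_density 0 1 z * exp (a * z\<^sup>2) \<partial>lborel) = 1 / sqrt (1 - 2 * a)"
proof -
  define \<sigma> where "\<sigma> = 1 / sqrt (1 - 2 * a)"
  have \<sigma>: "\<sigma> > 0" "\<sigma>\<^sup>2 = 1 / (1 - 2 * a)" using assms by (simp_all add: \<sigma>_def power_divide)
  have eq: "normal_density 0 1 z * exp (a * z\<^sup>2) = \<sigma> * normal_density 0 \<sigma> z" for z
  proof -
    have "normal_density 0 1 z * exp (a * z\<^sup>2) = 1 / sqrt (2 * pi) * exp (- z\<^sup>2 / 2 + a * z\<^sup>2)"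
      by (simp add: normal_density_def mult_exp_exp)
    also have "- z\<^sup>2 / 2 + a * z\<^sup>2 = - (z - 0)\<^sup>2 / (2 * \<sigma>\<^sup>2)"
      using assms by (simp add: \<sigma>(2) field_simps)
    also have "1 / sqrt (2 * pi) = \<sigma> * (1 / sqrt (2 * pi * \<sigma>\<^sup>2))"
      using \<sigma>(1) by (simp add: real_sqrt_mult)
    finally show ?thesis by (simp add: normal_density_def)
  qed
  show "integrable lborel (\<lambda>z. normal_density 0 1 z * exp (a * z\<^sup>2))"
    unfolding eq using \<sigma> by (simp add: integrable_normal_density)
  show "(\<integral>z. normal_density 0 1 z * exp (a * z\<^sup>2) \<partial>lborel) = 1 / sqrt (1 - 2 * a)"
    unfolding eq using \<sigma> by (simp add: integral_normal_density \<sigma>_def)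
qed

lemma sum_edges_le_square:
  fixes a :: "nat \<Rightarrow> real"
  shows "2 * (\<Sum>e\<in>edges n. a (fst e) * a (snd e)) \<le> (\<Sum>i<n. a i)\<^sup>2"
proof -
  have "(\<Sum>i<n. a i)\<^sup>2 = 2 * (\<Sum>e\<in>edges n. a (fst e) * a (snd e)) + (\<Sum>i<n. (a i)\<^sup>2)"
  proof (induction n)
    case (Suc n)
    have split: "edges (Suc n) = edges n \<union> (\<lambda>i. (i, n)) ` {..<n}" by (auto simp: edges_def)
    have "(\<Sum>e\<in>edges (Suc n). a (fst e) * a (snd e)) = (\<Sum>e\<in>edges n. a (fst e) * a (snd e)) + (\<Sum>i<n. a i * a n)"
      unfolding split
      by (subst sum.union_disjoint) (auto simp: edges_def[of n] finite_edges[unfolded edges_def] sum.reindex inj_on_def)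
    then show ?case using Suc by (simp add: power2_sum sum_distrib_right[symmetric] algebra_simps)
  qed (simp add: edges_def)
  then show ?thesis using sum_nonneg[of "{..<n}" "\<lambda>i. (a i)\<^sup>2"] by simp
qed

text \<open>The square in the exponent is linearised by an auxiliary standard Gaussian \<open>z\<close>, namely
  \<open>exp (\<kappa> S\<^sup>2 / 2) = E exp (sqrt \<kappa> S z)\<close>. For fixed \<open>z\<close> the mean over the independent variables
  factorises and is bounded by Hoeffding's lemma; what is left is a Gaussian integral in \<open>z\<close>. The
  index set \<open>B\<close> collects the nodes whose variable equals \<open>2\<close>.\<close>
lemma skew_quadratic_mgf:
  fixes \<theta> :: "nat \<Rightarrow> real"
  assumes "\<kappa> \<ge> 0" and small: "9 / 4 * (\<kappa> * (\<Sum>i<n. (\<theta> i)\<^sup>2)) < 1"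
  shows "(\<Sum>B\<in>Pow {..<n}. (\<Prod>i<n. if i \<in> B then 1 / 3 else 2 / 3) *
            exp (\<kappa> / 2 * (\<Sum>i<n. \<theta> i * (if i \<in> B then 2 else -1))\<^sup>2))
         \<le> 1 / sqrt (1 - 9 / 4 * (\<kappa> * (\<Sum>i<n. (\<theta> i)\<^sup>2)))"
proof -
  define W where "W = (\<lambda>B. \<Prod>i<n. if i \<in> B then 1 / 3 else 2 / 3 :: real)"
  define S where "S = (\<lambda>B. \<Sum>i<n. \<theta> i * (if i \<in> B then 2 else -1))"
  define a where "a = 9 / 8 * (\<kappa> * (\<Sum>i<n. (\<theta> i)\<^sup>2))"
  have lin: "exp (\<kappa> / 2 * (S B)\<^sup>2) = (\<integral>z. normal_density 0 1 z * exp ((sqrt \<kappa> * S B) * z) \<partial>lborel)" for B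
    unfolding gaussian_mgf using assms(1) by (simp add: power_mult_distrib)
  have mgf: "(\<Sum>B\<in>Pow {..<n}. W B * exp ((sqrt \<kappa> * S B) * z)) \<le> exp (a * z\<^sup>2)" for z
  proof -
    have "(\<Sum>B\<in>Pow {..<n}. W B * exp ((sqrt \<kappa> * S B) * z)) =
      (\<Sum>B\<in>Pow {..<n}. \<Prod>i<n. (if i \<in> B then 1 / 3 * exp (2 * (sqrt \<kappa> * \<theta> i * z)) else 2 / 3 * exp (- (sqrt \<kappa> * \<theta> i * z))))"
    proof (rule sum.cong[OF refl])
      fix B
      have "exp ((sqrt \<kappa> * S B) * z) = (\<Prod>i<n. exp ((sqrt \<kappa> * (\<theta> i * (if i \<in> B then 2 else -1))) * z))"
        by (simp add: S_def sum_distrib_left sum_distrib_right exp_sum)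
      then show "W B * exp ((sqrt \<kappa> * S B) * z) =
        (\<Prod>i<n. (if i \<in> B then 1 / 3 * exp (2 * (sqrt \<kappa> * \<theta> i * z)) else 2 / 3 * exp (- (sqrt \<kappa> * \<theta> i * z))))"
        by (simp add: W_def prod.distrib[symmetric] mult_ac if_distrib cong: if_cong) 
          (intro prod.cong, auto simp: mult_ac)
    qed
    also have "\<dots> = (\<Prod>i<n. 1 / 3 * exp (2 * (sqrt \<kappa> * \<theta> i * z)) + 2 / 3 * exp (- (sqrt \<kappa> * \<theta> i * z)))"
      using sum_Pow_prod[of "{..<n}" "\<lambda>i b. if b then 1 / 3 * exp (2 * (sqrt \<kappa> * \<theta> i * z)) else 2 / 3 * exp (- (sqrt \<kappa> * \<theta> i * z))"]
      by simp
    also have "\<dots> \<le> (\<Prod>i<n. exp (9 / 8 * (sqrt \<kappa> * \<theta> i * z)\<^sup>2))"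
      by (intro prod_mono conjI skew_mgf) (simp add: add_nonneg_nonneg)
    also have "\<dots> = exp (a * z\<^sup>2)"
      using assms(1) by (simp add: exp_sum[symmetric] a_def power_mult_distrib sum_distrib_left sum_distrib_right mult_ac)
    finally show ?thesis .
  qed
  have "(\<Sum>B\<in>Pow {..<n}. W B * exp (\<kappa> / 2 * (S B)\<^sup>2)) =
      (\<Sum>B\<in>Pow {..<n}. \<integral>z. W B * (normal_density 0 1 z * exp ((sqrt \<kappa> * S B) * z)) \<partial>lborel)"
    unfolding lin by simp
  also have "\<dots> = (\<integral>z. (\<Sum>B\<in>Pow {..<n}. W B * (normal_density 0 1 z * exp ((sqrt \<kappa> * S B) * z))) \<partial>lborel)"
    by (rule Bochner_Integration.integral_sum[symmetric]) (intro integrable_mult_right gaussian_mgf)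
  also have "\<dots> \<le> (\<integral>z. normal_density 0 1 z * exp (a * z\<^sup>2) \<partial>lborel)"
  proof (rule integral_mono)
    show "integrable lborel (\<lambda>z. \<Sum>B\<in>Pow {..<n}. W B * (normal_density 0 1 z * exp ((sqrt \<kappa> * S B) * z)))"
      by (intro Bochner_Integration.integrable_sum integrable_mult_right gaussian_mgf)
    show "integrable lborel (\<lambda>z. normal_density 0 1 z * exp (a * z\<^sup>2))"
      using small by (intro gaussian_quadratic_mgf) (simp add: a_def)
    fix z
    have "(\<Sum>B\<in>Pow {..<n}. W B * (normal_density 0 1 z * exp ((sqrt \<kappa> * S B) * z))) =
      normal_density 0 1 z * (\<Sum>B\<in>Pow {..<n}. W B * exp ((sqrt \<kappa> * S B) * z))"
      by (simp add: sum_distrib_left mult_ac)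
    also have "\<dots> \<le> normal_density 0 1 z * exp (a * z\<^sup>2)"
      by (intro mult_left_mono mgf) simp
    finally show "(\<Sum>B\<in>Pow {..<n}. W B * (normal_density 0 1 z * exp ((sqrt \<kappa> * S B) * z)))
      \<le> normal_density 0 1 z * exp (a * z\<^sup>2)" .
  qed
  also have "\<dots> = 1 / sqrt (1 - 2 * a)" using small by (intro gaussian_quadratic_mgf) (simp add: a_def)
  finally show ?thesis by (simp add: W_def S_def a_def)
qed

text \<open>Attach to the nodes independent skew variables \<open>g\<close>. The mean of \<open>\<Prod>\<^sub>e\<^sub>\<in>\<^sub>G g\<^sub>i g\<^sub>j\<close> is the product over
  the nodes of the moments of order given by the degrees: it is zero if \<open>G\<close> has a leaf and at least one
  otherwise, so it dominates the restriction to leafless graphs. Inserting it makes the sum over all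
  \<open>G\<close> collapse to a product over edges.\<close>
lemma sum_graphs_le:
  fixes \<theta> :: "nat \<Rightarrow> real" and T :: "(nat \<times> nat) set \<Rightarrow> real"
  assumes \<kappa>: "\<kappa> \<ge> 0" and \<theta>: "\<And>i. i < n \<Longrightarrow> \<theta> i \<ge> 0"
    and small: "9 / 4 * (\<kappa> * (\<Sum>i<n. (\<theta> i)\<^sup>2)) < 1"
    and bound: "\<And>G. G \<subseteq> edges n \<Longrightarrow> T G \<le> (\<Prod>e\<in>G. \<kappa> * (\<theta> (fst e) * \<theta> (snd e)))"
    and leaf: "\<And>G i. G \<subseteq> edges n \<Longrightarrow> i < n \<Longrightarrow> node_degree G i = 1 \<Longrightarrow> T G = 0"
  shows "(\<Sum>G\<in>Pow (edges n). T G) \<le> 1 / sqrt (1 - 9 / 4 * (\<kappa> * (\<Sum>i<n. (\<theta> i)\<^sup>2)))"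
proof -
  define W where "W = (\<lambda>B. \<Prod>i<n. if i \<in> B then 1 / 3 else 2 / 3 :: real)"
  define g where "g = (\<lambda>(B :: nat set) i. if i \<in> B then 2 else -1 :: real)"
  have g_bound: "g B i * g B j \<ge> - 2" for B i j by (simp add: g_def)
  have W0: "W B \<ge> 0" for B by (auto simp: W_def intro!: prod_nonneg)
  have moments: "(\<Sum>B\<in>Pow {..<n}. W B * (\<Prod>e\<in>G. g B (fst e) * g B (snd e))) = (\<Prod>i<n. skew_moment (node_degree G i))"
    if G: "G \<subseteq> edges n" for G
  proof -
    have "(\<Sum>B\<in>Pow {..<n}. W B * (\<Prod>e\<in>G. g B (fst e) * g B (snd e))) =
      (\<Sum>B\<in>Pow {..<n}. \<Prod>i<n. if i \<in> B then 1 / 3 * 2 ^ node_degree G i else 2 / 3 * (-1) ^ node_degree G i)"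
    proof (rule sum.cong[OF refl])
      fix B
      show "W B * (\<Prod>e\<in>G. g B (fst e) * g B (snd e)) =
        (\<Prod>i<n. if i \<in> B then 1 / 3 * 2 ^ node_degree G i else 2 / 3 * (-1) ^ node_degree G i)"
        unfolding prod_edges_eq_prod_degree[OF G, of "g B"] W_def prod.distrib[symmetric]
        by (intro prod.cong) (auto simp: g_def)
    qed
    also have "\<dots> = (\<Prod>i<n. skew_moment (node_degree G i))"
      using sum_Pow_prod[of "{..<n}" "\<lambda>i b. if b then 1 / 3 * 2 ^ node_degree G i else 2 / 3 * (-1 :: real) ^ node_degree G i"]
      by (simp add: skew_moment_def)
    finally show ?thesis .
  qed
  have edge_nonneg: "0 \<le> \<kappa> * (\<theta> (fst e) * \<theta> (snd e))" if "e \<in> edges n" for e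
    using that \<kappa> \<theta> by (auto simp: edges_def)
  \<comment> \<open>As \<open>g\<close> takes values in \<open>{-1, 2}\<close>, a product of two of them may be \<open>-2\<close>; this bound keeps the factors
    \<open>1 + \<kappa> \<theta>\<^sub>i \<theta>\<^sub>j g\<^sub>i g\<^sub>j\<close> nonnegative, so that they may be replaced by exponentials one by one.\<close>
  have half: "\<kappa> * (\<theta> (fst e) * \<theta> (snd e)) \<le> 1 / 2" if e_edge: "e \<in> edges n" for e
  proof -
    obtain i j where e: "e = (i, j)" "i < j" "j < n"
      using e_edge by (cases e) (auto simp: edges_def)
    have "(\<Sum>k\<in>{i, j}. (\<theta> k)\<^sup>2) \<le> (\<Sum>k<n. (\<theta> k)\<^sup>2)" using e by (intro sum_mono2) auto
    then have "(\<theta> i)\<^sup>2 + (\<theta> j)\<^sup>2 \<le> (\<Sum>k<n. (\<theta> k)\<^sup>2)" using e by simp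
    moreover have "2 * (\<theta> i * \<theta> j) \<le> (\<theta> i)\<^sup>2 + (\<theta> j)\<^sup>2"
      using sum_squares_bound[of "\<theta> i" "\<theta> j"] by simp
    ultimately have "\<kappa> * (2 * (\<theta> i * \<theta> j)) \<le> \<kappa> * (\<Sum>k<n. (\<theta> k)\<^sup>2)" using \<kappa> by (intro mult_left_mono) auto
    then show ?thesis using small e by simp
  qed
  have term_le: "T G \<le> (\<Sum>B\<in>Pow {..<n}. W B * (\<Prod>e\<in>G. \<kappa> * (\<theta> (fst e) * \<theta> (snd e)) * (g B (fst e) * g B (snd e))))"
    if G: "G \<subseteq> edges n" for G
  proof -
    define w where "w = (\<Prod>e\<in>G. \<kappa> * (\<theta> (fst e) * \<theta> (snd e)))"
    have w0: "w \<ge> 0" unfolding w_def using G edge_nonneg by (intro prod_nonneg) auto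
    have "T G \<le> w * (\<Prod>i<n. skew_moment (node_degree G i))"
    proof (cases "\<exists>i<n. node_degree G i = 1")
      case True
      then obtain i where i: "i < n" "node_degree G i = 1" by blast
      then have "(\<Prod>i<n. skew_moment (node_degree G i)) = 0"
        using skew_moment_1 by (intro prod_zero) (auto intro!: bexI[of _ i])
      then show ?thesis using leaf[OF G i] by (simp only: mult_zero_right order_refl)
    next
      case False
      have "1 \<le> (\<Prod>i<n. skew_moment (node_degree G i))"
        using False by (intro prod_ge_1 skew_moment_ge_1) auto
      then have "w * 1 \<le> w * (\<Prod>i<n. skew_moment (node_degree G i))" using w0 by (rule mult_left_mono)
      then show ?thesis using bound[OF G] by (simp add: w_def)
    qed
    also have "\<dots> = (\<Sum>B\<in>Pow {..<n}. W B * (\<Prod>e\<in>G. \<kappa> * (\<theta> (fst e) * \<theta> (snd e)) * (g B (fst e) * g B (snd e))))"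
      unfolding moments[OF G, symmetric] w_def by (simp add: sum_distrib_left prod.distrib mult_ac)
    finally show ?thesis .
  qed
  have "(\<Sum>G\<in>Pow (edges n). T G) \<le>
      (\<Sum>G\<in>Pow (edges n). \<Sum>B\<in>Pow {..<n}. W B * (\<Prod>e\<in>G. \<kappa> * (\<theta> (fst e) * \<theta> (snd e)) * (g B (fst e) * g B (snd e))))"
    by (intro sum_mono term_le) auto
  also have "\<dots> = (\<Sum>B\<in>Pow {..<n}. W B * (\<Sum>G\<in>Pow (edges n). \<Prod>e\<in>G. \<kappa> * (\<theta> (fst e) * \<theta> (snd e)) * (g B (fst e) * g B (snd e))))"
    by (subst sum.swap) (simp add: sum_distrib_left)
  also have "\<dots> = (\<Sum>B\<in>Pow {..<n}. W B * (\<Prod>e\<in>edges n. \<kappa> * (\<theta> (fst e) * \<theta> (snd e)) * (g B (fst e) * g B (snd e)) + 1))"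
    by (subst prod_add) auto
  also have "\<dots> \<le> (\<Sum>B\<in>Pow {..<n}. W B * exp (\<kappa> / 2 * (\<Sum>i<n. \<theta> i * g B i)\<^sup>2))"
  proof (intro sum_mono mult_left_mono W0)
    fix B
    have "(\<Prod>e\<in>edges n. \<kappa> * (\<theta> (fst e) * \<theta> (snd e)) * (g B (fst e) * g B (snd e)) + 1) \<le>
      (\<Prod>e\<in>edges n. exp (\<kappa> * (\<theta> (fst e) * \<theta> (snd e)) * (g B (fst e) * g B (snd e))))"
    proof (intro prod_mono conjI)
      fix e assume e: "e \<in> edges n"
      have "\<kappa> * (\<theta> (fst e) * \<theta> (snd e)) * (-2) \<le> \<kappa> * (\<theta> (fst e) * \<theta> (snd e)) * (g B (fst e) * g B (snd e))"
        using g_bound edge_nonneg[OF e] by (rule mult_left_mono)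
      then show "0 \<le> \<kappa> * (\<theta> (fst e) * \<theta> (snd e)) * (g B (fst e) * g B (snd e)) + 1"
        using half[OF e] by linarith
      show "\<kappa> * (\<theta> (fst e) * \<theta> (snd e)) * (g B (fst e) * g B (snd e)) + 1 \<le>
          exp (\<kappa> * (\<theta> (fst e) * \<theta> (snd e)) * (g B (fst e) * g B (snd e)))"
        by (metis add.commute exp_ge_add_one_self)
    qed
    also have "\<dots> = exp (\<kappa> / 2 * (2 * (\<Sum>e\<in>edges n. (\<theta> (fst e) * g B (fst e)) * (\<theta> (snd e) * g B (snd e)))))"
      by (simp add: exp_sum[symmetric] sum_distrib_left mult_ac)
    also have "\<dots> \<le> exp (\<kappa> / 2 * (\<Sum>i<n. \<theta> i * g B i)\<^sup>2)"
      using sum_edges_le_square[where n = n and a = "\<lambda>i. \<theta> i * g B i"] \<kappa> by (simp del: times_divide_eq_left add: mult_left_mono)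
    finally show "(\<Prod>e\<in>edges n. \<kappa> * (\<theta> (fst e) * \<theta> (snd e)) * (g B (fst e) * g B (snd e)) + 1) \<le>
      exp (\<kappa> / 2 * (\<Sum>i<n. \<theta> i * g B i)\<^sup>2)" .
  qed
  also have "\<dots> \<le> 1 / sqrt (1 - 9 / 4 * (\<kappa> * (\<Sum>i<n. (\<theta> i)\<^sup>2)))"
    unfolding W_def g_def by (rule skew_quadratic_mgf[OF \<kappa> small])
  finally show ?thesis .
qed

section \<open>The random graph laws as finite sums\<close>

lemma pmf_bernoulli_clip: "pmf (bernoulli_pmf p) b = bern (min 1 (max 0 p)) b"
  by (simp add: bernoulli_pmf.rep_eq bern_def)

lemma pmf_bernoulli_eq_bern: "p \<in> {0..1} \<Longrightarrow> pmf (bernoulli_pmf p) b = bern p b"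
  by (simp add: pmf_bernoulli_clip)

text \<open>The adjacency matrix of the graph with edge set \<open>S\<close>, for \<open>S\<close> consisting of pairs \<open>(i, j)\<close>
  with \<open>i < j\<close>.\<close>
definition adj_of :: "(nat \<times> nat) set \<Rightarrow> nat \<Rightarrow> nat \<Rightarrow> nat" where
  "adj_of S i j = of_bool ((min i j, max i j) \<in> S)"

lemma inj_on_adj_of: "inj_on adj_of (Pow (edges n))"
proof (rule inj_onI)
  fix S T assume "S \<in> Pow (edges n)" "T \<in> Pow (edges n)" and eq: "adj_of S = adj_of T"
  then have lt: "i < j" if "(i, j) \<in> S \<union> T" for i j using that by (auto simp: edges_def)
  have "(i, j) \<in> S \<longleftrightarrow> (i, j) \<in> T" if "i < j" for i j
    using fun_cong[OF fun_cong[OF eq], of i j] that by (simp add: adj_of_def of_bool_def split: if_splits)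
  then show "S = T" using lt by auto
qed

definition graph_prob :: "nat \<Rightarrow> (nat \<Rightarrow> nat \<Rightarrow> real) \<Rightarrow> (nat \<times> nat) set \<Rightarrow> real" where
  "graph_prob n \<Omega> S = (\<Prod>e\<in>edges n. pmf (bernoulli_pmf (\<Omega> (fst e) (snd e))) (e \<in> S))"

lemma graph_prob_nonneg: "graph_prob n \<Omega> S \<ge> 0"
  unfolding graph_prob_def by (intro prod_nonneg) simp

lemma graph_prob_le_1: "graph_prob n \<Omega> S \<le> 1"
  unfolding graph_prob_def by (intro prod_le_1) (simp add: pmf_le_1)

lemma nn_integral_adj_law:
  "(\<integral>\<^sup>+ x. f x \<partial>measure_pmf (adj_law n \<Omega>)) =
    (\<Sum>S\<in>Pow (edges n). ennreal (graph_prob n \<Omega> S) * f (adj_of S))"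
proof -
  define M where "M = Pi_pmf (edges n) False (\<lambda>(i, j). bernoulli_pmf (\<Omega> i j))"
  define ind where "ind = (\<lambda>(S :: (nat \<times> nat) set) e. e \<in> S)"
  have "(\<integral>\<^sup>+ x. f x \<partial>measure_pmf (adj_law n \<Omega>)) = (\<integral>\<^sup>+ E. f (\<lambda>i j. of_bool (E (min i j, max i j))) \<partial>measure_pmf M)"
    by (simp add: adj_law_def M_def edges_def)
  also have "\<dots> = (\<Sum>E\<in>ind ` Pow (edges n). f (\<lambda>i j. of_bool (E (min i j, max i j))) * pmf M E)"
  proof (rule nn_integral_measure_pmf_support)
    fix E assume E: "E \<in> set_pmf M" "E \<notin> ind ` Pow (edges n)"
    have "E = ind {e. E e}" by (simp add: ind_def)
    moreover have "{e. E e} \<in> Pow (edges n)"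
      using E(1) set_Pi_pmf_subset[of "edges n" False "\<lambda>(i, j). bernoulli_pmf (\<Omega> i j)"] by (auto simp: M_def)
    ultimately show "f (\<lambda>i j. of_bool (E (min i j, max i j))) = 0" using E(2) by blast
  qed auto
  also have "\<dots> = (\<Sum>S\<in>Pow (edges n). f (adj_of S) * pmf M (ind S))"
    by (subst sum.reindex) (auto simp: inj_on_def ind_def fun_eq_iff adj_of_def[abs_def])
  also have "\<dots> = (\<Sum>S\<in>Pow (edges n). ennreal (graph_prob n \<Omega> S) * f (adj_of S))"
  proof (rule sum.cong[OF refl])
    fix S assume "S \<in> Pow (edges n)"
    then have "pmf M (ind S) = graph_prob n \<Omega> S"
      unfolding M_def by (subst pmf_Pi') (auto simp: ind_def graph_prob_def case_prod_unfold)
    then show "f (adj_of S) * pmf M (ind S) = ennreal (graph_prob n \<Omega> S) * f (adj_of S)"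
      by (simp add: mult.commute)
  qed
  finally show ?thesis .
qed

lemma emeasure_adj_law:
  "emeasure (measure_pmf (adj_law n \<Omega>)) X =
    (\<Sum>S\<in>Pow (edges n). ennreal (graph_prob n \<Omega> S) * indicator X (adj_of S))"
  using nn_integral_adj_law[where f = "indicator X"] by simp

text \<open>If both laws live on the same finite set and every atom has positive mass under the first, then
  the ratio of the masses is a density, and \<open>RN_deriv\<close> agrees with it almost everywhere.\<close>
lemma chi_square_dist_finite:
  fixes p0 p1 :: "'s \<Rightarrow> real" and M0 :: "'a pmf"
  assumes fin: "finite U" and inj: "inj_on g U"
    and p0: "\<And>s. s \<in> U \<Longrightarrow> p0 s > 0" and p1: "\<And>s. s \<in> U \<Longrightarrow> p1 s \<ge> 0"
    and M0: "\<And>f. (\<integral>\<^sup>+ x. f x \<partial>measure_pmf M0) = (\<Sum>s\<in>U. ennreal (p0 s) * f (g s))"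
    and M1: "\<And>X. emeasure M1 X = (\<Sum>s\<in>U. ennreal (p1 s) * indicator X (g s))" "sets M1 = UNIV"
  shows "chi_square_dist (measure_pmf M0) M1 = ereal ((\<Sum>s\<in>U. (p1 s)\<^sup>2 / p0 s) - 1)"
proof -
  define f where "f x = ennreal (p1 (the_inv_into U g x) / p0 (the_inv_into U g x))" for x
  have fg: "f (g s) = ennreal (p1 s / p0 s)" if "s \<in> U" for s
    using that inj by (simp add: f_def the_inv_into_f_f)
  have dens: "density (measure_pmf M0) f = M1"
  proof (rule measure_eqI)
    show "sets (density (measure_pmf M0) f) = sets M1" using M1(2) by simp
    fix X
    have "emeasure (density (measure_pmf M0) f) X = (\<integral>\<^sup>+ x. f x * indicator X x \<partial>measure_pmf M0)"
      by (simp add: emeasure_density)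
    also have "\<dots> = (\<Sum>s\<in>U. ennreal (p0 s) * (f (g s) * indicator X (g s)))" by (rule M0)
    also have "\<dots> = (\<Sum>s\<in>U. ennreal (p1 s) * indicator X (g s))"
    proof (rule sum.cong[OF refl])
      fix s assume s: "s \<in> U"
      then have "ennreal (p0 s) * ennreal (p1 s / p0 s) = ennreal (p1 s)"
        using p0[OF s] p1[OF s] by (subst ennreal_mult[symmetric]) auto
      then show "ennreal (p0 s) * (f (g s) * indicator X (g s)) = ennreal (p1 s) * indicator X (g s)"
        using fg[OF s] by (simp add: mult.assoc[symmetric])
    qed
    finally show "emeasure (density (measure_pmf M0) f) X = emeasure M1 X" by (simp add: M1(1))
  qed
  have ac: "absolutely_continuous (measure_pmf M0) M1"
    unfolding dens[symmetric] by (rule absolutely_continuousI_density) simp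
  have "AE x in measure_pmf M0. f x = RN_deriv (measure_pmf M0) M1 x"
    by (rule measure_pmf.RN_deriv_unique[OF _ dens]) simp
  then have "(\<integral>\<^sup>+ x. (RN_deriv (measure_pmf M0) M1 x)\<^sup>2 \<partial>measure_pmf M0) = (\<integral>\<^sup>+ x. (f x)\<^sup>2 \<partial>measure_pmf M0)"
    by (intro nn_integral_cong_AE) (auto elim!: eventually_mono)
  also have "\<dots> = (\<Sum>s\<in>U. ennreal (p0 s) * (f (g s))\<^sup>2)" by (rule M0)
  also have "\<dots> = (\<Sum>s\<in>U. ennreal ((p1 s)\<^sup>2 / p0 s))"
  proof (rule sum.cong[OF refl])
    fix s assume s: "s \<in> U"
    have "ennreal (p0 s) * (f (g s))\<^sup>2 = ennreal (p0 s) * ennreal ((p1 s / p0 s)\<^sup>2)"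
      using fg[OF s] p0[OF s] p1[OF s] by (simp add: ennreal_power)
    also have "\<dots> = ennreal (p0 s * (p1 s / p0 s)\<^sup>2)"
      using p0[OF s] by (subst ennreal_mult) auto
    also have "p0 s * (p1 s / p0 s)\<^sup>2 = (p1 s)\<^sup>2 / p0 s"
      using p0[OF s] by (simp add: power2_eq_square)
    finally show "ennreal (p0 s) * (f (g s))\<^sup>2 = ennreal ((p1 s)\<^sup>2 / p0 s)" .
  qed
  also have "\<dots> = ennreal (\<Sum>s\<in>U. (p1 s)\<^sup>2 / p0 s)"
    using p0 by (intro sum_ennreal) (simp add: less_imp_le)
  finally have "(\<integral>\<^sup>+ x. (RN_deriv (measure_pmf M0) M1 x)\<^sup>2 \<partial>measure_pmf M0) = ennreal (\<Sum>s\<in>U. (p1 s)\<^sup>2 / p0 s)" .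
  moreover have "(\<Sum>s\<in>U. (p1 s)\<^sup>2 / p0 s) \<ge> 0" using p0 by (intro sum_nonneg) (simp add: less_imp_le)
  ultimately show ?thesis using ac by (simp add: chi_square_dist_def one_ereal_def)
qed

section \<open>The chi-square distance of a fixed pair of hypotheses\<close>

lemma measurable_matrix_vector_mult [measurable]:
  fixes P :: "real ^ 'k ^ 'k"
  shows "(\<lambda>x. P *v x) \<in> borel_measurable borel"
  by (intro borel_measurable_continuous_onI linear_continuous_on linear_linear[THEN iffD2] matrix_vector_mul_linear)

locale dcmm_pair =
  fixes F :: "(real ^ 'k) measure" and h :: "real ^ 'k" and P :: "real ^ 'k ^ 'k"
    and q C :: real and n :: nat and \<theta> :: "nat \<Rightarrow> real"
  assumes card: "CARD('k) > 1"
    and F_prob: "prob_space F" and F_sets: "sets F = sets borel"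
    and F_simplex: "AE x in F. x \<in> prob_simplex"
    and h_def: "h = (LINT x|F. x)"
    and \<theta>_pos: "\<And>i. i < n \<Longrightarrow> \<theta> i > 0"
    and P_sym: "transpose P = P" and P_nonneg: "\<And>k l. P $ k $ l \<ge> 0"
    and P_diag: "\<And>k. P $ k $ k = 1"
    and q_pos: "q > 0" and Ph: "P *v h = q *\<^sub>R vec 1"
    and alt_prob: "AE \<pi> in membership_law n F. \<forall>i j. i < j \<longrightarrow> j < n \<longrightarrow> Omega_alt \<theta> P \<pi> i j \<in> {0..1}"
    and C_pos: "C > 0" and h_ge: "\<And>k. h $ k \<ge> C"
begin

sublocale F: prob_space F by (rule F_prob)

sublocale memb: product_prob_space "\<lambda>_. F" "I" for I :: "nat set"
  by unfold_locales

sublocale M: prob_space "membership_law n F"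
  unfolding membership_law_def by (rule memb.P.prob_space_axioms)

lemma measurable_coord [measurable]: "i < n \<Longrightarrow> (\<lambda>\<pi>. \<pi> i) \<in> borel_measurable (membership_law n F)"
  unfolding membership_law_def
  using measurable_component_singleton[of i "{..<n}" "\<lambda>_. F"] F_sets
  by (simp cong: measurable_cong_sets)

lemma measurable_Omega_alt: "i < n \<Longrightarrow> j < n \<Longrightarrow> (\<lambda>\<pi>. Omega_alt \<theta> P \<pi> i j) \<in> borel_measurable (membership_law n F)"
  unfolding Omega_alt_def
  by (intro borel_measurable_times borel_measurable_inner measurable_compose[OF measurable_coord measurable_matrix_vector_mult]
      measurable_coord borel_measurable_const)

lemma h_simplex: "h \<in> prob_simplex"
  and F_integrable: "integrable F (\<lambda>x. x)"
proof -
  have meas: "(\<lambda>x. x) \<in> borel_measurable F"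
    using F_sets by (simp cong: measurable_cong_sets)
  have "AE x in F. norm x \<le> 1"
    using F_simplex by eventually_elim (rule norm_prob_simplex_le_1)
  then show int: "integrable F (\<lambda>x. x)" using meas by (rule F.integrable_const_bound)
  have "(\<Sum>k\<in>UNIV. h $ k) = h \<bullet> 1" by (simp add: inner_vec_def)
  also have "\<dots> = (LINT x|F. x \<bullet> 1)" unfolding h_def using int by simp
  also have "\<dots> = (LINT x|F. 1)"
  proof (rule integral_cong_AE)
    show "AE x in F. x \<bullet> 1 = 1" using F_simplex by eventually_elim (rule prob_simplex_inner_one)
    show "(\<lambda>x. x \<bullet> 1) \<in> borel_measurable F" using int by (intro borel_measurable_integrable integrable_inner_left) simp
  qed simp
  also have "\<dots> = 1" using F.prob_space by simp
  finally show "h \<in> prob_simplex" using h_ge C_pos by (auto simp: prob_simplex_def intro: order.trans less_imp_le)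
qed

lemma AE_simplex: "AE \<pi> in PiM I (\<lambda>_. F). \<pi> i \<in> prob_simplex" if "i \<in> I"
  using that by (intro AE_PiM_component F_prob F_simplex)

definition deviation :: "(nat \<Rightarrow> real ^ 'k) \<Rightarrow> nat \<times> nat \<Rightarrow> real" where
  "deviation \<pi> e = Omega_alt \<theta> P \<pi> (fst e) (snd e) - Omega_null \<theta> q (fst e) (snd e)"

lemma deviation_eq: "deviation \<pi> (i, j) = \<theta> i * \<theta> j * (\<pi> i \<bullet> (P *v \<pi> j) - q)"
  by (simp add: deviation_def Omega_alt_def Omega_null_def algebra_simps)

lemma deviation_swap: "deviation \<pi> (i, j) = deviation \<pi> (j, i)"
  using symmetric_matrix_inner[OF P_sym, of "\<pi> i" "\<pi> j"] by (simp add: deviation_eq inner_commute)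

text \<open>The bound on \<open>\<bar>\<pi>\<^sub>i \<bullet> P \<pi>\<^sub>j - q\<bar>\<close>, a constant multiple of \<open>\<bar>\<mu>\<^sub>2(P)\<bar>\<close>.\<close>
definition spread :: real where
  "spread = 4 * (1 + 1 / C\<^sup>2) * \<bar>eigval_mag 2 P\<bar>"

lemma spread_nonneg: "spread \<ge> 0"
  by (simp add: spread_def)

lemma affinity_near_q: "x \<in> prob_simplex \<Longrightarrow> z \<in> prob_simplex \<Longrightarrow> \<bar>x \<bullet> (P *v z) - q\<bar> \<le> spread"
  unfolding spread_def
  by (rule affinity_deviation_bound[OF card P_sym P_nonneg Ph h_simplex C_pos h_ge])

text \<open>The unit diagonal of \<open>P\<close> says that a vertex of the simplex has affinity \<open>1\<close> with itself.\<close>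
lemma q_le: "q \<le> 1 + spread"
proof -
  define k :: 'k where "k = undefined"
  have s: "axis k 1 \<in> prob_simplex"
    by (auto simp: prob_simplex_def axis_def if_distrib cong: if_cong)
  have "axis k 1 \<bullet> (P *v axis k 1) = 1"
    using P_diag[of k] by (simp add: inner_axis' matrix_vector_mult_basis column_def)
  then show ?thesis using affinity_near_q[OF s s] by linarith
qed

lemma q_ge: "C \<le> q"
proof -
  define k :: 'k where "k = undefined"
  have hpos: "h $ l \<ge> 0" for l using h_ge[of l] C_pos by linarith
  have "C \<le> P $ k $ k * h $ k" using P_diag[of k] h_ge[of k] by simp
  also have "\<dots> \<le> (\<Sum>l\<in>UNIV. P $ k $ l * h $ l)"
    using hpos P_nonneg by (intro member_le_sum) auto
  also have "\<dots> = q" using Ph by (simp add: vec_eq_iff matrix_vector_mult_def)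
  finally show ?thesis .
qed

lemma AE_deviation_bound:
  "AE \<pi> in membership_law n F. \<forall>e\<in>edges n. \<bar>deviation \<pi> e\<bar> \<le> spread * (\<theta> (fst e) * \<theta> (snd e))"
proof -
  have "AE \<pi> in membership_law n F. \<forall>i\<in>{..<n}. \<pi> i \<in> prob_simplex"
    unfolding membership_law_def by (intro AE_finite_allI AE_simplex) auto
  then show ?thesis
  proof eventually_elim
    case (elim \<pi>)
    show ?case
    proof
      fix e assume "e \<in> edges n"
      then obtain i j where e: "e = (i, j)" "i < n" "j < n" by (cases e) (auto simp: edges_def)
      have "\<bar>deviation \<pi> e\<bar> = \<theta> i * \<theta> j * \<bar>\<pi> i \<bullet> (P *v \<pi> j) - q\<bar>"
        using \<theta>_pos[of i] \<theta>_pos[of j] e by (simp add: deviation_eq abs_mult)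
      also have "\<dots> \<le> \<theta> i * \<theta> j * spread"
        using \<theta>_pos[of i] \<theta>_pos[of j] e elim by (intro mult_left_mono affinity_near_q) auto
      finally show "\<bar>deviation \<pi> e\<bar> \<le> spread * (\<theta> (fst e) * \<theta> (snd e))" by (simp add: e mult_ac)
    qed
  qed
qed

lemma measurable_deviation: "e \<in> edges n \<Longrightarrow> (\<lambda>\<pi>. deviation \<pi> e) \<in> borel_measurable (membership_law n F)"
  unfolding deviation_def by (intro borel_measurable_diff measurable_Omega_alt borel_measurable_const) (auto simp: edges_def)

lemma AE_prod_deviation_bound:
  assumes "G \<subseteq> edges n"
  shows "AE \<pi> in membership_law n F. \<bar>\<Prod>e\<in>G. deviation \<pi> e\<bar> \<le> (\<Prod>e\<in>G. spread * (\<theta> (fst e) * \<theta> (snd e)))"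
  using AE_deviation_bound
  by eventually_elim (use assms in \<open>auto simp: abs_prod intro!: prod_mono\<close>)

lemma integrable_prod_deviation:
  assumes "G \<subseteq> edges n"
  shows "integrable (membership_law n F) (\<lambda>\<pi>. \<Prod>e\<in>G. deviation \<pi> e)"
proof (rule M.integrable_const_bound)
  show "AE \<pi> in membership_law n F. norm (\<Prod>e\<in>G. deviation \<pi> e) \<le> (\<Prod>e\<in>G. spread * (\<theta> (fst e) * \<theta> (snd e)))"
    using AE_prod_deviation_bound[OF assms] by simp
  show "(\<lambda>\<pi>. \<Prod>e\<in>G. deviation \<pi> e) \<in> borel_measurable (membership_law n F)"
    using assms by (intro borel_measurable_prod measurable_deviation) auto
qed

definition subgraph_mean :: "(nat \<times> nat) set \<Rightarrow> real" where
  "subgraph_mean G = (\<integral>\<pi>. (\<Prod>e\<in>G. deviation \<pi> e) \<partial>membership_law n F)"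

lemma subgraph_mean_bound:
  assumes "G \<subseteq> edges n"
  shows "\<bar>subgraph_mean G\<bar> \<le> (\<Prod>e\<in>G. spread * (\<theta> (fst e) * \<theta> (snd e)))"
proof -
  have "\<bar>subgraph_mean G\<bar> \<le> (\<integral>\<pi>. \<bar>\<Prod>e\<in>G. deviation \<pi> e\<bar> \<partial>membership_law n F)"
    unfolding subgraph_mean_def by (rule integral_abs_bound)
  also have "\<dots> \<le> (\<Prod>e\<in>G. spread * (\<theta> (fst e) * \<theta> (snd e)))"
    by (intro M.integral_le_const integrable_abs integrable_prod_deviation AE_prod_deviation_bound assms)
  finally show ?thesis .
qed

lemma integral_affinity: "z \<in> prob_simplex \<Longrightarrow> (LINT y|F. y \<bullet> (P *v z) - q) = 0"
proof -
  assume z: "z \<in> prob_simplex"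
  have "(LINT y|F. y \<bullet> (P *v z) - q) = h \<bullet> (P *v z) - q"
    using F_integrable F.prob_space by (simp add: h_def)
  also have "h \<bullet> (P *v z) = q"
    using symmetric_matrix_inner[OF P_sym, of h z] Ph prob_simplex_inner_one[OF z] by (simp add: inner_commute)
  finally show ?thesis by simp
qed

text \<open>Let \<open>(i, j)\<close> be the only edge of \<open>G\<close> at the leaf \<open>i\<close>. Integrating out \<open>\<pi>\<^sub>i\<close> first, only the factor
  of this edge is affected, and its mean is \<open>h \<bullet> P \<pi>\<^sub>j - q = 0\<close>.\<close>
lemma subgraph_mean_leaf:
  assumes G: "G \<subseteq> edges n" and i: "i < n" and deg: "node_degree G i = 1"
  shows "subgraph_mean G = 0"
proof -
  have fin: "finite G" using G finite_edges finite_subset by blast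
  obtain e0 where e0: "{e \<in> G. fst e = i \<or> snd e = i} = {e0}"
    using deg unfolding node_degree_def by (rule card_1_singletonE)
  then have e0G: "e0 \<in> G" and inc: "fst e0 = i \<or> snd e0 = i" by auto
  define j where "j = (if fst e0 = i then snd e0 else fst e0)"
  have j: "j < n" "j \<noteq> i" using e0G G inc by (auto simp: j_def edges_def split: if_splits)
  have dev0: "deviation \<pi> e0 = deviation \<pi> (i, j)" for \<pi>
    using inc deviation_swap[of \<pi> "fst e0" "snd e0"] by (cases e0) (auto simp: j_def)
  have others: "fst e \<noteq> i \<and> snd e \<noteq> i" if "e \<in> G - {e0}" for e using that e0 by auto
  define I where "I = {..<n} - {i}"
  have I: "insert i I = {..<n}" "i \<notin> I" "finite I" using i by (auto simp: I_def)
  have "subgraph_mean G = (\<integral>x. (\<integral>y. (\<Prod>e\<in>G. deviation (x(i := y)) e) \<partial>F) \<partial>PiM I (\<lambda>_. F))"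
    unfolding subgraph_mean_def membership_law_def I(1)[symmetric]
    using integrable_prod_deviation[OF G] I
    by (intro memb.product_integral_insert) (auto simp: membership_law_def)
  also have "\<dots> = 0"
  proof (rule integral_eq_zero_AE)
    have "AE x in PiM I (\<lambda>_. F). x j \<in> prob_simplex" using j i by (intro AE_simplex) (auto simp: I_def)
    then show "AE x in PiM I (\<lambda>_. F). (\<integral>y. (\<Prod>e\<in>G. deviation (x(i := y)) e) \<partial>F) = 0"
    proof eventually_elim
      case (elim x)
      have "(\<Prod>e\<in>G. deviation (x(i := y)) e) =
          (\<theta> i * \<theta> j * (\<Prod>e\<in>G - {e0}. deviation x e)) * (y \<bullet> (P *v x j) - q)" for y
      proof -
        have "(\<Prod>e\<in>G. deviation (x(i := y)) e) = deviation (x(i := y)) e0 * (\<Prod>e\<in>G - {e0}. deviation (x(i := y)) e)"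
          using fin e0G by (rule prod.remove)
        also have "(\<Prod>e\<in>G - {e0}. deviation (x(i := y)) e) = (\<Prod>e\<in>G - {e0}. deviation x e)"
          using others by (intro prod.cong) (auto simp: deviation_def Omega_alt_def)
        also have "deviation (x(i := y)) e0 = \<theta> i * \<theta> j * (y \<bullet> (P *v x j) - q)"
          using j by (simp add: dev0 deviation_eq)
        finally show ?thesis by (simp only: mult_ac)
      qed
      then show ?case using integral_affinity[OF elim] by simp
    qed
  qed
  finally show ?thesis .
qed

text \<open>The monadic bind of measures is meaningful only for measurable kernels. As adjacency matrices take
  finitely many values, measurability reduces to that of finitely many polynomials in the clipped edge
  probabilities.\<close>
lemma law_alt_kernel:
  "(\<lambda>\<pi>. measure_pmf (adj_law n (Omega_alt \<theta> P \<pi>))) \<in> measurable (membership_law n F) (subprob_algebra (count_space UNIV))"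
  and measurable_graph_prob: "(\<lambda>\<pi>. graph_prob n (Omega_alt \<theta> P \<pi>) S) \<in> borel_measurable (membership_law n F)"
proof -
  show meas: "(\<lambda>\<pi>. graph_prob n (Omega_alt \<theta> P \<pi>) S) \<in> borel_measurable (membership_law n F)" for S
    unfolding graph_prob_def
  proof (rule borel_measurable_prod)
    fix e assume "e \<in> edges n"
    then have [measurable]: "(\<lambda>\<pi>. Omega_alt \<theta> P \<pi> (fst e) (snd e)) \<in> borel_measurable (membership_law n F)"
      by (intro measurable_Omega_alt) (auto simp: edges_def)
    show "(\<lambda>\<pi>. pmf (bernoulli_pmf (Omega_alt \<theta> P \<pi> (fst e) (snd e))) (e \<in> S)) \<in> borel_measurable (membership_law n F)"
      unfolding pmf_bernoulli_clip bern_def by measurable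
  qed
  show "(\<lambda>\<pi>. measure_pmf (adj_law n (Omega_alt \<theta> P \<pi>))) \<in> measurable (membership_law n F) (subprob_algebra (count_space UNIV))"
  proof (rule measurable_subprob_algebra)
    show "(\<lambda>\<pi>. emeasure (measure_pmf (adj_law n (Omega_alt \<theta> P \<pi>))) X) \<in> borel_measurable (membership_law n F)" for X
      unfolding emeasure_adj_law using meas by (intro borel_measurable_sum borel_measurable_times measurable_compose[OF meas measurable_ennreal]) auto
  qed (auto intro: measure_pmf.subprob_space_axioms)
qed

definition mixture_prob :: "(nat \<times> nat) set \<Rightarrow> real" where
  "mixture_prob S = (\<integral>\<pi>. graph_prob n (Omega_alt \<theta> P \<pi>) S \<partial>membership_law n F)"

lemma emeasure_law_alt:
  "emeasure (law_alt n \<theta> P F) X = (\<Sum>S\<in>Pow (edges n). ennreal (mixture_prob S) * indicator X (adj_of S))"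
proof -
  have "emeasure (law_alt n \<theta> P F) X =
      (\<integral>\<^sup>+ \<pi>. emeasure (measure_pmf (adj_law n (Omega_alt \<theta> P \<pi>))) X \<partial>membership_law n F)"
    unfolding law_alt_def using M.not_empty law_alt_kernel by (rule emeasure_bind) simp
  also have "\<dots> = (\<Sum>S\<in>Pow (edges n). (\<integral>\<^sup>+ \<pi>. ennreal (graph_prob n (Omega_alt \<theta> P \<pi>) S) * indicator X (adj_of S) \<partial>membership_law n F))"
    unfolding emeasure_adj_law using measurable_graph_prob
    by (intro nn_integral_sum borel_measurable_times measurable_compose[OF measurable_graph_prob measurable_ennreal]) auto
  also have "\<dots> = (\<Sum>S\<in>Pow (edges n). ennreal (mixture_prob S) * indicator X (adj_of S))"
  proof (rule sum.cong[OF refl])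
    fix S
    have int: "integrable (membership_law n F) (\<lambda>\<pi>. graph_prob n (Omega_alt \<theta> P \<pi>) S)"
      using measurable_graph_prob graph_prob_nonneg graph_prob_le_1
      by (intro M.integrable_const_bound[of _ 1]) auto
    have "(\<integral>\<^sup>+ \<pi>. ennreal (graph_prob n (Omega_alt \<theta> P \<pi>) S) * indicator X (adj_of S) \<partial>membership_law n F)
        = (\<integral>\<^sup>+ \<pi>. ennreal (graph_prob n (Omega_alt \<theta> P \<pi>) S) \<partial>membership_law n F) * indicator X (adj_of S)"
      by (intro nn_integral_multc measurable_compose[OF measurable_graph_prob measurable_ennreal])
    also have "(\<integral>\<^sup>+ \<pi>. ennreal (graph_prob n (Omega_alt \<theta> P \<pi>) S) \<partial>membership_law n F) = ennreal (mixture_prob S)"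
      unfolding mixture_prob_def using int graph_prob_nonneg by (intro nn_integral_eq_integral) auto
    finally show "(\<integral>\<^sup>+ \<pi>. ennreal (graph_prob n (Omega_alt \<theta> P \<pi>) S) * indicator X (adj_of S) \<partial>membership_law n F)
       = ennreal (mixture_prob S) * indicator X (adj_of S)" .
  qed
  finally show ?thesis .
qed

lemma sets_law_alt: "sets (law_alt n \<theta> P F) = UNIV"
  unfolding law_alt_def using M.not_empty by (subst sets_bind[where N = "count_space UNIV"]) auto

text \<open>Each edge likelihood under the alternative is the null likelihood plus or minus \<open>deviation\<close>, with
  the sign determined by the presence of the edge. Multiplying out and taking means over the memberships
  gives the coefficients \<open>subgraph_mean\<close>.\<close>
lemma mixture_prob_expansion:
  "mixture_prob S = (\<Sum>G\<in>Pow (edges n). subgraph_mean G *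
     (\<Prod>e\<in>edges n. if e \<in> G then (if e \<in> S then 1 else -1) else bern (Omega_null \<theta> q (fst e) (snd e)) (e \<in> S)))"
proof -
  define p where "p e = Omega_null \<theta> q (fst e) (snd e)" for e
  define sg where "sg e = (if e \<in> S then 1 else -1 :: real)" for e
  define \<psi> where "\<psi> G = (\<Prod>e\<in>edges n. if e \<in> G then sg e else bern (p e) (e \<in> S))" for G
  have split: "(\<Prod>e\<in>edges n. sg e * deviation \<pi> e + bern (p e) (e \<in> S)) =
      (\<Sum>G\<in>Pow (edges n). (\<Prod>e\<in>G. deviation \<pi> e) * \<psi> G)" for \<pi>
  proof -
    have "(\<Prod>e\<in>edges n. sg e * deviation \<pi> e + bern (p e) (e \<in> S)) =
      (\<Sum>G\<in>Pow (edges n). \<Prod>e\<in>edges n. if e \<in> G then sg e * deviation \<pi> e else bern (p e) (e \<in> S))"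
      using sum_Pow_prod[of "edges n" "\<lambda>e b. if b then sg e * deviation \<pi> e else bern (p e) (e \<in> S)"] by simp
    also have "\<dots> = (\<Sum>G\<in>Pow (edges n). (\<Prod>e\<in>G. deviation \<pi> e) * \<psi> G)"
    proof (rule sum.cong[OF refl])
      fix G assume "G \<in> Pow (edges n)"
      then have "(\<Prod>e\<in>G. deviation \<pi> e) = (\<Prod>e\<in>edges n. if e \<in> G then deviation \<pi> e else 1)"
        by (simp add: prod.inter_restrict[symmetric] Int_absorb1)
      then show "(\<Prod>e\<in>edges n. if e \<in> G then sg e * deviation \<pi> e else bern (p e) (e \<in> S)) = (\<Prod>e\<in>G. deviation \<pi> e) * \<psi> G"
        unfolding \<psi>_def by (simp add: prod.distrib[symmetric]) (intro prod.cong, auto)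
    qed
    finally show ?thesis .
  qed
  have "mixture_prob S = (\<integral>\<pi>. (\<Sum>G\<in>Pow (edges n). (\<Prod>e\<in>G. deviation \<pi> e) * \<psi> G) \<partial>membership_law n F)"
    unfolding mixture_prob_def
  proof (rule integral_cong_AE)
    show "(\<lambda>\<pi>. \<Sum>G\<in>Pow (edges n). (\<Prod>e\<in>G. deviation \<pi> e) * \<psi> G) \<in> borel_measurable (membership_law n F)"
      by (intro borel_measurable_sum borel_measurable_times borel_measurable_const borel_measurable_integrable integrable_prod_deviation) auto
    show "AE \<pi> in membership_law n F. graph_prob n (Omega_alt \<theta> P \<pi>) S = (\<Sum>G\<in>Pow (edges n). (\<Prod>e\<in>G. deviation \<pi> e) * \<psi> G)"
      using alt_prob
    proof eventually_elim
      case (elim \<pi>)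
      show ?case unfolding graph_prob_def split[symmetric]
      proof (rule prod.cong[OF refl])
        fix e assume "e \<in> edges n"
        then have "Omega_alt \<theta> P \<pi> (fst e) (snd e) \<in> {0..1}" using elim by (auto simp: edges_def)
        then have "pmf (bernoulli_pmf (Omega_alt \<theta> P \<pi> (fst e) (snd e))) (e \<in> S) = bern (p e + deviation \<pi> e) (e \<in> S)"
          by (simp add: pmf_bernoulli_eq_bern deviation_def p_def)
        then show "pmf (bernoulli_pmf (Omega_alt \<theta> P \<pi> (fst e) (snd e))) (e \<in> S) = sg e * deviation \<pi> e + bern (p e) (e \<in> S)"
          by (simp add: bern_def sg_def)
      qed
    qed
  qed (rule measurable_graph_prob)
  also have "\<dots> = (\<Sum>G\<in>Pow (edges n). \<integral>\<pi>. (\<Prod>e\<in>G. deviation \<pi> e) * \<psi> G \<partial>membership_law n F)"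
    by (intro Bochner_Integration.integral_sum integrable_mult_left integrable_prod_deviation) auto
  also have "\<dots> = (\<Sum>G\<in>Pow (edges n). subgraph_mean G * \<psi> G)"
    by (simp add: subgraph_mean_def)
  finally show ?thesis by (simp only: \<psi>_def sg_def p_def)
qed

lemma chi_square_expansion:
  assumes p: "\<And>e. e \<in> edges n \<Longrightarrow> Omega_null \<theta> q (fst e) (snd e) < 1"
  shows "chi_square_dist (law_null n \<theta> q) (law_alt n \<theta> P F) =
    ereal ((\<Sum>G\<in>Pow (edges n). (subgraph_mean G)\<^sup>2 *
      (\<Prod>e\<in>G. 1 / (Omega_null \<theta> q (fst e) (snd e) * (1 - Omega_null \<theta> q (fst e) (snd e))))) - 1)"
proof -
  define p where "p e = Omega_null \<theta> q (fst e) (snd e)" for e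
  have p01: "0 < p e \<and> p e < 1" if "e \<in> edges n" for e
    using that assms[OF that] q_pos \<theta>_pos by (auto simp: p_def Omega_null_def edges_def)
  have null: "graph_prob n (Omega_null \<theta> q) S = (\<Prod>e\<in>edges n. bern (p e) (e \<in> S))" for S
    unfolding graph_prob_def
  proof (rule prod.cong[OF refl])
    fix e assume "e \<in> edges n"
    then show "pmf (bernoulli_pmf (Omega_null \<theta> q (fst e) (snd e))) (e \<in> S) = bern (p e) (e \<in> S)"
      using p01[of e] by (subst pmf_bernoulli_eq_bern) (auto simp: p_def)
  qed
  have null_pos: "graph_prob n (Omega_null \<theta> q) S > 0" for S
    unfolding null using p01 by (intro prod_pos) (auto simp: bern_def)
  have "chi_square_dist (law_null n \<theta> q) (law_alt n \<theta> P F) =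
     ereal ((\<Sum>S\<in>Pow (edges n). (mixture_prob S)\<^sup>2 / graph_prob n (Omega_null \<theta> q) S) - 1)"
    unfolding law_null_def
  proof (rule chi_square_dist_finite[where g = adj_of])
    show "mixture_prob S \<ge> 0" for S
      unfolding mixture_prob_def using graph_prob_nonneg by (intro integral_nonneg_AE) auto
    show "inj_on adj_of (Pow (edges n))" by (rule inj_on_adj_of)
    show "(\<integral>\<^sup>+ x. f x \<partial>measure_pmf (adj_law n (Omega_null \<theta> q))) =
       (\<Sum>S\<in>Pow (edges n). ennreal (graph_prob n (Omega_null \<theta> q) S) * f (adj_of S))" for f
      by (rule nn_integral_adj_law)
    show "sets (law_alt n \<theta> P F) = UNIV" by (rule sets_law_alt)
    show "emeasure (law_alt n \<theta> P F) X = (\<Sum>S\<in>Pow (edges n). ennreal (mixture_prob S) * indicator X (adj_of S))" for X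
      by (rule emeasure_law_alt)
  qed (auto simp: null_pos)
  also have "(\<Sum>S\<in>Pow (edges n). (mixture_prob S)\<^sup>2 / graph_prob n (Omega_null \<theta> q) S) =
      (\<Sum>G\<in>Pow (edges n). (subgraph_mean G)\<^sup>2 * (\<Prod>e\<in>G. 1 / (p e * (1 - p e))))"
    unfolding null mixture_prob_expansion p_def[symmetric]
    by (rule chi_square_orthogonality) (use p01 in auto)
  finally show ?thesis by (simp only: p_def)
qed

text \<open>The empty graph contributes exactly \<open>1\<close> to the expansion, whence the lower bound. For the upper
  bound, a single edge contributes at most \<open>(spread \<theta>\<^sub>i \<theta>\<^sub>j)\<^sup>2 / (q \<theta>\<^sub>i \<theta>\<^sub>j (1 - p))\<close>, where one factor
  \<open>\<theta>\<^sub>i \<theta>\<^sub>j\<close> cancels; \<open>C \<le> q\<close> and \<open>p \<le> \<rho>\<close> bound the rest.\<close>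
lemma chi_square_dist_bounds:
  assumes \<rho>: "\<rho> < 1" "\<And>e. e \<in> edges n \<Longrightarrow> Omega_null \<theta> q (fst e) (snd e) \<le> \<rho>"
    and s_def: "s = spread\<^sup>2 / (C * (1 - \<rho>)) * (\<Sum>i<n. (\<theta> i)\<^sup>2)" and s: "9 / 4 * s < 1"
  shows "0 \<le> chi_square_dist (law_null n \<theta> q) (law_alt n \<theta> P F)"
    and "chi_square_dist (law_null n \<theta> q) (law_alt n \<theta> P F) \<le> ereal (1 / sqrt (1 - 9 / 4 * s) - 1)"
proof -
  define p where "p e = Omega_null \<theta> q (fst e) (snd e)" for e
  define T where "T G = (subgraph_mean G)\<^sup>2 * (\<Prod>e\<in>G. 1 / (p e * (1 - p e)))" for G
  define \<kappa> where "\<kappa> = spread\<^sup>2 / (C * (1 - \<rho>))"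
  have \<kappa>0: "\<kappa> \<ge> 0" using C_pos \<rho> by (simp add: \<kappa>_def)
  have p0: "p e > 0" if "e \<in> edges n" for e
    using that q_pos \<theta>_pos by (auto simp: p_def Omega_null_def edges_def)
  have p1: "p e < 1" if "e \<in> edges n" for e using \<rho>(1) \<rho>(2)[OF that] by (simp add: p_def)
  have chi: "chi_square_dist (law_null n \<theta> q) (law_alt n \<theta> P F) = ereal ((\<Sum>G\<in>Pow (edges n). T G) - 1)"
    using chi_square_expansion p1 by (simp add: T_def p_def)
  have T0: "T G \<ge> 0" if "G \<subseteq> edges n" for G
    unfolding T_def using that p0 p1 by (intro mult_nonneg_nonneg prod_nonneg) (auto simp: less_imp_le subset_eq)
  have "T {} = 1" using M.prob_space by (simp add: T_def subgraph_mean_def)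
  then have "1 \<le> (\<Sum>G\<in>Pow (edges n). T G)"
    using member_le_sum[of "{}" "Pow (edges n)" T] T0 by auto
  then show "0 \<le> chi_square_dist (law_null n \<theta> q) (law_alt n \<theta> P F)" by (simp add: chi)
  have "(\<Sum>G\<in>Pow (edges n). T G) \<le> 1 / sqrt (1 - 9 / 4 * (\<kappa> * (\<Sum>i<n. (\<theta> i)\<^sup>2)))"
  proof (rule sum_graphs_le[OF \<kappa>0])
    show "\<theta> i \<ge> 0" if "i < n" for i using \<theta>_pos[OF that] by simp
    show "9 / 4 * (\<kappa> * (\<Sum>i<n. (\<theta> i)\<^sup>2)) < 1" using s by (simp add: s_def \<kappa>_def)
    show "T G = 0" if "G \<subseteq> edges n" "i < n" "node_degree G i = 1" for G i
      using subgraph_mean_leaf[OF that] by (simp add: T_def)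
    fix G assume G: "G \<subseteq> edges n"
    have "T G \<le> (\<Prod>e\<in>G. spread * (\<theta> (fst e) * \<theta> (snd e)))\<^sup>2 * (\<Prod>e\<in>G. 1 / (p e * (1 - p e)))"
      unfolding T_def using subgraph_mean_bound[OF G] p0 p1 G
      by (intro mult_right_mono prod_nonneg) (auto simp: less_imp_le subset_eq intro: power2_le_iff_abs_le[THEN iffD2])
    also have "\<dots> = (\<Prod>e\<in>G. (spread * (\<theta> (fst e) * \<theta> (snd e)))\<^sup>2 / (p e * (1 - p e)))"
      by (simp add: prod_power_distrib prod_dividef)
    also have "\<dots> \<le> (\<Prod>e\<in>G. \<kappa> * (\<theta> (fst e) * \<theta> (snd e)))"
    proof (rule prod_mono)
      fix e assume "e \<in> G"
      then have e: "e \<in> edges n" using G by auto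
      define t where "t = \<theta> (fst e) * \<theta> (snd e)"
      have t: "t > 0" using e \<theta>_pos by (auto simp: t_def edges_def)
      have pe: "p e = q * t" by (simp add: p_def Omega_null_def t_def)
      have "C * (1 - \<rho>) \<le> q * (1 - p e)"
        using q_ge \<rho> \<rho>(2)[OF e] C_pos by (intro mult_mono) (auto simp: p_def)
      moreover have "C * (1 - \<rho>) > 0" using C_pos \<rho> by simp
      ultimately have "spread\<^sup>2 * t / (q * (1 - p e)) \<le> spread\<^sup>2 * t / (C * (1 - \<rho>))"
        using t by (intro divide_left_mono) auto
      moreover have "(spread * t)\<^sup>2 / (p e * (1 - p e)) = spread\<^sup>2 * t / (q * (1 - p e))"
        using t by (simp add: pe power2_eq_square)
      moreover have "0 \<le> (spread * t)\<^sup>2 / (p e * (1 - p e))"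
        using p0[OF e] p1[OF e] by (intro divide_nonneg_nonneg mult_nonneg_nonneg) auto
      ultimately show "0 \<le> (spread * (\<theta> (fst e) * \<theta> (snd e)))\<^sup>2 / (p e * (1 - p e)) \<and>
          (spread * (\<theta> (fst e) * \<theta> (snd e)))\<^sup>2 / (p e * (1 - p e)) \<le> \<kappa> * (\<theta> (fst e) * \<theta> (snd e))"
        by (simp add: t_def[symmetric] \<kappa>_def)
    qed
    finally show "T G \<le> (\<Prod>e\<in>G. \<kappa> * (\<theta> (fst e) * \<theta> (snd e)))" .
  qed
  then show "chi_square_dist (law_null n \<theta> q) (law_alt n \<theta> P F) \<le> ereal (1 / sqrt (1 - 9 / 4 * s) - 1)"
    by (simp add: chi s_def \<kappa>_def)
qed

end


section \<open>The limit\<close>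

theorem theorem3p5:
  fixes F :: "(real ^ 'k) measure"
    and h :: "real ^ 'k"
    and \<theta> :: "nat \<Rightarrow> nat \<Rightarrow> real"
    and P :: "nat \<Rightarrow> real ^ 'k ^ 'k"
    and q :: "nat \<Rightarrow> real"
    and c\<^sub>0 C :: real
  assumes "CARD('k) > 1"
    and "prob_space F" "sets F = sets borel" "AE x in F. x \<in> prob_simplex"
    and "h = (LINT x|F. x)"
    and "\<And>n i. i < n \<Longrightarrow> \<theta> n i > 0"
    and "\<And>n. transpose (P n) = P n"
    and "\<And>n k l. P n $ k $ l \<ge> 0"
    and "\<And>n k. P n $ k $ k = 1"
    and "\<And>n. q n > 0"
    and "\<And>n. P n *v h = q n *\<^sub>R vec 1"
    and "\<And>n i j. i < j \<Longrightarrow> j < n \<Longrightarrow> Omega_null (\<theta> n) (q n) i j \<in> {0..1}"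
    and "\<And>n. AE \<pi> in membership_law n F.
               \<forall>i j. i < j \<longrightarrow> j < n \<longrightarrow> Omega_alt (\<theta> n) (P n) \<pi> i j \<in> {0..1}"
    and "c\<^sub>0 < 1" "\<And>n. n > 0 \<Longrightarrow> (MAX i\<in>{..<n}. \<theta> n i) \<le> c\<^sub>0"
    and "C > 0" "(MIN k. h $ k) \<ge> C"
    and "(\<lambda>n. L2_set (\<theta> n) {..<n} * \<bar>eigval_mag 2 (P n)\<bar>) \<longlonglongrightarrow> 0"
  shows "(\<lambda>n. chi_square_dist (law_null n (\<theta> n) (q n)) (law_alt n (\<theta> n) (P n) F)) \<longlonglongrightarrow> 0"
proof -
  define B where "B = 4 * (1 + 1 / C\<^sup>2)"
  define L where "L n = L2_set (\<theta> n) {..<n}" for n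
  define a where "a n = L n * \<bar>eigval_mag 2 (P n)\<bar>" for n
  define \<rho> where "\<rho> = (1 + c\<^sub>0) / 2"
  define s where "s n = B\<^sup>2 / (C * (1 - \<rho>)) * (a n)\<^sup>2" for n
  have \<rho>: "\<rho> < 1" using assms(14) by (simp add: \<rho>_def)
  have h_ge: "C \<le> h $ k" for k
    using assms(17) Min_le[of "range (\<lambda>k. h $ k)" "h $ k"] by simp
  have pair: "dcmm_pair F h (P n) (q n) C n (\<theta> n)" for n
    by (intro dcmm_pair.intro assms h_ge)
  have a_lim: "a \<longlonglongrightarrow> 0" using assms(18) by (simp add: a_def[abs_def] L_def)
  have "s \<longlonglongrightarrow> B\<^sup>2 / (C * (1 - \<rho>)) * 0\<^sup>2"
    unfolding s_def[abs_def] by (intro tendsto_mult tendsto_power tendsto_const a_lim)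
  then have s_lim: "s \<longlonglongrightarrow> 0" by simp
  have "(\<lambda>n. B * a n) \<longlonglongrightarrow> B * 0" by (intro tendsto_mult tendsto_const a_lim)
  then have Ba_lim: "(\<lambda>n. B * a n) \<longlonglongrightarrow> 0" by simp
  have Ba: "\<forall>\<^sub>F n in sequentially. B * a n < (1 - c\<^sub>0) / 2"
    using assms(14) by (intro order_tendstoD(2)[OF Ba_lim]) simp
  have s_small: "\<forall>\<^sub>F n in sequentially. s n < 4 / 9"
    by (intro order_tendstoD(2)[OF s_lim]) simp
  have bounds: "\<forall>\<^sub>F n in sequentially. 0 \<le> chi_square_dist (law_null n (\<theta> n) (q n)) (law_alt n (\<theta> n) (P n) F)
      \<and> chi_square_dist (law_null n (\<theta> n) (q n)) (law_alt n (\<theta> n) (P n) F) \<le> ereal (1 / sqrt (1 - 9 / 4 * s n) - 1)"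
    using Ba s_small
  proof eventually_elim
    case (elim n)
    interpret dcmm_pair F h "P n" "q n" C n "\<theta> n" by (rule pair)
    have spread: "spread = B * \<bar>eigval_mag 2 (P n)\<bar>" by (simp add: spread_def B_def)
    \<comment> \<open>\<open>q \<le> 1 + spread\<close>, where \<open>spread\<close> need not be small when \<open>\<parallel>\<theta>\<parallel>\<close> is; but
      \<open>\<theta>\<^sub>i \<theta>\<^sub>j \<le> \<parallel>\<theta>\<parallel>\<close>, and \<open>spread \<parallel>\<theta>\<parallel>\<close> tends to zero.\<close>
    have null_le: "Omega_null (\<theta> n) (q n) (fst e) (snd e) \<le> \<rho>" if e_edge: "e \<in> edges n" for e
    proof -
      obtain i j where e: "e = (i, j)" "i < j" "j < n" using e_edge by (cases e) (auto simp: edges_def)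
      have le_c0: "\<theta> n k \<le> c\<^sub>0" if "k < n" for k
      proof -
        have "\<theta> n k \<le> (MAX i\<in>{..<n}. \<theta> n i)" by (rule Max_ge) (use that in auto)
        also have "\<dots> \<le> c\<^sub>0" using that by (intro assms(15)) simp
        finally show ?thesis .
      qed
      have pos: "\<theta> n i > 0" "\<theta> n j > 0" using \<theta>_pos e by auto
      have iL: "\<theta> n i \<le> L n" unfolding L_def using e by (intro member_le_L2_set) auto
      have j1: "\<theta> n j \<le> 1" using le_c0[of j] e assms(14) by simp
      have tc: "\<theta> n i * \<theta> n j \<le> c\<^sub>0"
        using mult_mono[of "\<theta> n i" c\<^sub>0 "\<theta> n j" 1] le_c0[of i] e pos j1 by auto
      have tL: "\<theta> n i * \<theta> n j \<le> L n"
        using mult_mono[of "\<theta> n i" "L n" "\<theta> n j" 1] iL pos j1 by auto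
      have "q n * (\<theta> n i * \<theta> n j) \<le> (1 + spread) * (\<theta> n i * \<theta> n j)"
        using q_le pos by (intro mult_right_mono) auto
      also have "\<dots> = \<theta> n i * \<theta> n j + spread * (\<theta> n i * \<theta> n j)" by (simp add: algebra_simps)
      also have "\<dots> \<le> c\<^sub>0 + spread * L n"
        using tc tL spread_nonneg by (intro add_mono mult_left_mono) auto
      also have "spread * L n = B * a n" by (simp add: spread a_def)
      also have "c\<^sub>0 + B * a n \<le> \<rho>" using elim(1) by (simp add: \<rho>_def field_simps)
      finally show ?thesis by (simp add: e Omega_null_def)
    qed
    have s_eq: "s n = spread\<^sup>2 / (C * (1 - \<rho>)) * (\<Sum>i<n. (\<theta> n i)\<^sup>2)"
    proof -
      have "(L n)\<^sup>2 = (\<Sum>i<n. (\<theta> n i)\<^sup>2)" by (simp add: L_def L2_set_def sum_nonneg)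
      then show ?thesis by (simp add: s_def a_def spread power_mult_distrib)
    qed
    show ?case using chi_square_dist_bounds[OF \<rho> null_le s_eq] elim(2) by simp
  qed
  have "(\<lambda>n. 1 / sqrt (1 - 9 / 4 * s n) - 1) \<longlonglongrightarrow> 1 / sqrt (1 - 9 / 4 * 0) - 1"
    by (intro tendsto_intros s_lim) auto
  then have upper: "(\<lambda>n. ereal (1 / sqrt (1 - 9 / 4 * s n) - 1)) \<longlonglongrightarrow> 0"
    by (simp add: zero_ereal_def)
  show ?thesis
    by (rule tendsto_sandwich[OF _ _ tendsto_const upper]; use bounds in \<open>auto elim: eventually_mono\<close>)
qed

end
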